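(* Let $C(D)_H$ be a cleft Hopf Galois coextension with (convolution invertible) total cointegral $f\colon C\to H$. Then $C^D$ is a right-left stable anti Yetter-Drinfeld module over $H$ by the original action of $H$ and the left coaction given by $$c\longmapsto f^{-1}(c^{(3)})f(c^{(1)})\otimes c^{(2)}.$$
   Context: All Hopf algebras, algebras and coalgebras are over a field; every Hopf algebra $H$ has an invertible antipode $S$. Sweedler notation: $\Delta(c)=c^{(1)}\otimes c^{(2)}$; left coactions are $m\mapsto m_{\langle -1\rangle}\otimes m_{\langle 0\rangle}$. For a right $H$-module coalgebra $C$, let $I=\mathrm{span}\{ch-\varepsilon(h)c\}$ (a coideal), $D=C/I$ the quotient coalgebra and $\pi\colon C\to D$ the projection, which makes $C$ a $D$-bicomodule. $C(D)_H$ is a (right) Hopf Galois coextension if $can\colon C\otimes H\to C\Box_D C$, $c\otimes h\mapsto c^{(1)}\otimes c^{(2)}h$, is bijective. With $D^*$ the algebraic dual of $D$, $C^D=\{c\in C: c^{(1)}\varphi(\pi(c^{(2)}))=c^{(2)}\varphi(\pi(c^{(1)}))\ \text{for all }\varphi\in D^*\}$. A total cointegral is a linear map $f\colon C\to H$ with $\varepsilon(f(c))=\varepsilon(c)$ and $f(ch)=f(c)h$. The coextension is cleft if there is a total cointegral which is convolution invertible; $f^{-1}$ denotes the convolution inverse. A right $H$-module and left $H$-comodule $M$ (coaction $\rho$) is a right-left anti Yetter-Drinfeld module if $\rho(mh)=S(h^{(3)})m_{\langle -1\rangle}h^{(1)}\otimes m_{\langle 0\rangle}h^{(2)}$; it is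 stable if $m_{\langle 0\rangle}m_{\langle -1\rangle}=m$ for all $m$. *)

theory Defs
  imports Complex_Main "HOL-Library.Poly_Mapping"
begin

text \<open>
  Vector spaces over a field \<open>'k\<close> are types of class \<open>ab_group_add\<close> together with a scalar
  multiplication satisfying the library locale \<open>vector_space\<close>.  Subspaces are subsets of such types.
\<close>

section \<open>Quotient spaces\<close>

text \<open>
  The set of cosets of a subspace \<open>N\<close> is not a type of class \<open>ab_group_add\<close>, so the coset \<open>v + N\<close> is
  encoded by the evaluation at \<open>v\<close> of the linear functionals vanishing on \<open>N\<close>.  Over a field this
  loses nothing: \<open>qproj s N\<close> below is linear with kernel exactly \<open>N\<close> (lemmas \<open>linear_qproj\<close> and
  \<open>qproj_eq_iff\<close>), hence its range is the quotient space \<open>V / N\<close>.  The type \<open>quot\<close> itself is only an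
  ambient vector space for that range.
\<close>

datatype ('k, 'v) quot = Quot (quot_eval: "('v \<Rightarrow> 'k) \<Rightarrow> 'k")

instantiation quot :: (ab_group_add, type) ab_group_add
begin

definition "0 = Quot (\<lambda>\<phi>. 0)"
definition "x + y = Quot (\<lambda>\<phi>. quot_eval x \<phi> + quot_eval y \<phi>)"
definition "- x = Quot (\<lambda>\<phi>. - quot_eval x \<phi>)"
definition "x - y = Quot (\<lambda>\<phi>. quot_eval x \<phi> - quot_eval y \<phi>)"

instance
  by standard
    (auto simp: zero_quot_def plus_quot_def uminus_quot_def minus_quot_def algebra_simps)

end

definition qscale :: "'k::field \<Rightarrow> ('k, 'v) quot \<Rightarrow> ('k, 'v) quot" where
  "qscale a x = Quot (\<lambda>\<phi>. a * quot_eval x \<phi>)"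

lemma vector_space_qscale: "vector_space qscale"
  by standard (auto simp: qscale_def plus_quot_def algebra_simps quot.expand)

definition qproj ::
  "('k::field \<Rightarrow> 'v::ab_group_add \<Rightarrow> 'v) \<Rightarrow> 'v set \<Rightarrow> 'v \<Rightarrow> ('k, 'v) quot" where
  "qproj s N v =
     Quot (\<lambda>\<phi>. if Vector_Spaces.linear s (*) \<phi> \<and> (\<forall>n\<in>N. \<phi> n = 0) then \<phi> v else 0)"

lemma vector_space_field: "vector_space ((*) :: 'k::field \<Rightarrow> 'k \<Rightarrow> 'k)"
  by standard (auto simp: algebra_simps)

lemma linear_qproj:
  assumes "vector_space s"
  shows "Vector_Spaces.linear s qscale (qproj s N)"
proof -
  have "qproj s N (x + y) = qproj s N x + qproj s N y" for x y
    by (auto simp: qproj_def plus_quot_def Vector_Spaces.linear_iff)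
  moreover have "qproj s N (s a x) = qscale a (qproj s N x)" for a x
    by (auto simp: qproj_def qscale_def Vector_Spaces.linear_iff)
  ultimately show ?thesis
    using assms vector_space_qscale by (simp add: Vector_Spaces.linear_iff)
qed

lemma separating_functional:
  assumes "vector_space s" "module.subspace s N" "v \<notin> N"
  shows "\<exists>\<phi>. Vector_Spaces.linear s (*) \<phi> \<and> (\<forall>n\<in>N. \<phi> n = 0) \<and> \<phi> v = 1"
proof -
  interpret vector_space s by fact
  interpret k: vector_space "(*) :: 'a \<Rightarrow> 'a \<Rightarrow> 'a" by (rule vector_space_field)
  interpret p: vector_space_pair s "(*)" ..
  obtain B where B: "B \<subseteq> N" "independent B" "N \<subseteq> span B"
    using maximal_independent_subset by blast
  have "span B = N"
    using B assms(2) by (simp add: span_subspace)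
  then have "v \<notin> span B" "v \<notin> B"
    using assms(3) B(1) by auto
  then have "independent (insert v B)"
    using B(2) by (simp add: independent_insertI)
  then obtain g where g: "Vector_Spaces.linear s (*) g"
      "\<forall>x\<in>insert v B. g x = (if x = v then 1 else 0)"
    using p.linear_independent_extend[of "insert v B" "\<lambda>x. if x = v then 1 else 0"] by blast
  have "g n = 0" if "n \<in> N" for n
  proof -
    have "\<And>x. x \<in> B \<Longrightarrow> g x = 0"
      using g(2) \<open>v \<notin> B\<close> by auto
    then show ?thesis
      using p.linear_eq_0_on_span[OF g(1), of B n] that B(3) by blast
  qed
  then show ?thesis
    using g by auto
qed

lemma qproj_eq_iff:
  assumes "vector_space s" "module.subspace s N"
  shows "qproj s N v = qproj s N w \<longleftrightarrow> v - w \<in> N"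
proof
  assume eq: "qproj s N v = qproj s N w"
  show "v - w \<in> N"
  proof (rule ccontr)
    assume "v - w \<notin> N"
    then obtain \<phi> where \<phi>: "Vector_Spaces.linear s (*) \<phi>" "\<forall>n\<in>N. \<phi> n = 0" "\<phi> (v - w) = 1"
      using separating_functional[OF assms] by blast
    have "\<phi> v = \<phi> w"
      using eq \<phi>(1,2) by (auto simp: qproj_def dest!: fun_cong[of _ _ \<phi>])
    moreover have "\<phi> (v - w) = \<phi> v - \<phi> w"
      using \<phi>(1) by (simp add: linear_iff_module_hom module_hom.diff)
    ultimately show False
      using \<phi>(3) by simp
  qed
next
  assume N: "v - w \<in> N"
  have "\<phi> v = \<phi> w" if "Vector_Spaces.linear s (*) \<phi>" "\<forall>n\<in>N. \<phi> n = 0" for \<phi>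
  proof -
    have "\<phi> (v - w) = \<phi> v - \<phi> w"
      using that(1) by (simp add: linear_iff_module_hom module_hom.diff)
    then show ?thesis
      using that(2) N by simp
  qed
  then show "qproj s N v = qproj s N w"
    by (auto simp: qproj_def)
qed

text \<open>
  A linear choice of representatives of the elements of \<open>V / N\<close>.  A linear map \<open>F\<close> vanishing on \<open>N\<close>
  induces \<open>F \<circ> qrep s N\<close> on \<open>V / N\<close>, independently of the choice.
\<close>

definition qrep ::
  "('k::field \<Rightarrow> 'v::ab_group_add \<Rightarrow> 'v) \<Rightarrow> 'v set \<Rightarrow> ('k, 'v) quot \<Rightarrow> 'v" where
  "qrep s N = (SOME g. Vector_Spaces.linear qscale s g \<and>
                       (\<forall>v. qproj s N (g (qproj s N v)) = qproj s N v))"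

lemma qrep:
  assumes "vector_space s"
  shows "Vector_Spaces.linear qscale s (qrep s N)"
    and "qproj s N (qrep s N (qproj s N v)) = qproj s N v"
proof -
  interpret vector_space s by fact
  interpret q: vector_space "qscale :: 'a \<Rightarrow> ('a, 'b) quot \<Rightarrow> ('a, 'b) quot"
    by (rule vector_space_qscale)
  interpret p: vector_space_pair s "qscale :: 'a \<Rightarrow> ('a, 'b) quot \<Rightarrow> ('a, 'b) quot" ..
  have "\<exists>g. Vector_Spaces.linear qscale s g \<and>
          (\<forall>v. qproj s N (g (qproj s N v)) = qproj s N v)"
    using p.linear_exists_right_inverse_on[OF linear_qproj[OF assms, of N] subspace_UNIV] by blast
  from someI_ex[OF this] show "Vector_Spaces.linear qscale s (qrep s N)"
    "qproj s N (qrep s N (qproj s N v)) = qproj s N v"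
    unfolding qrep_def[symmetric] by blast+
qed

section \<open>Tensor products\<close>

definition bilinear_map ::
  "('k::field \<Rightarrow> 'v::ab_group_add \<Rightarrow> 'v) \<Rightarrow> ('k \<Rightarrow> 'w::ab_group_add \<Rightarrow> 'w) \<Rightarrow>
   ('k \<Rightarrow> 'u::ab_group_add \<Rightarrow> 'u) \<Rightarrow> ('v \<Rightarrow> 'w \<Rightarrow> 'u) \<Rightarrow> bool" where
  "bilinear_map sV sW sU m \<longleftrightarrow>
     (\<forall>w. Vector_Spaces.linear sV sU (\<lambda>v. m v w)) \<and> (\<forall>v. Vector_Spaces.linear sW sU (m v))"

text \<open>
  \<open>V \<otimes> W\<close> is the free vector space on \<open>V \<times> W\<close> (finitely supported functions) modulo the span of
  the bilinearity relations.
\<close>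

definition pm_scale :: "'k::field \<Rightarrow> ('x \<Rightarrow>\<^sub>0 'k) \<Rightarrow> ('x \<Rightarrow>\<^sub>0 'k)" where
  "pm_scale a = Poly_Mapping.map ((*) a)"

definition tensor_relators ::
  "('k::field \<Rightarrow> 'v::ab_group_add \<Rightarrow> 'v) \<Rightarrow> ('k \<Rightarrow> 'w::ab_group_add \<Rightarrow> 'w) \<Rightarrow>
   (('v \<times> 'w) \<Rightarrow>\<^sub>0 'k) set" where
  "tensor_relators sV sW =
     (let e = (\<lambda>v w. Poly_Mapping.single (v, w) 1) in
       {e (v + v') w - e v w - e v' w | v v' w. True} \<union>
       {e v (w + w') - e v w - e v w' | v w w'. True} \<union>
       {e (sV a v) w - pm_scale a (e v w) | a v w. True} \<union>
       {e v (sW a w) - pm_scale a (e v w) | a v w. True})"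

definition tensor_null ::
  "('k::field \<Rightarrow> 'v::ab_group_add \<Rightarrow> 'v) \<Rightarrow> ('k \<Rightarrow> 'w::ab_group_add \<Rightarrow> 'w) \<Rightarrow>
   (('v \<times> 'w) \<Rightarrow>\<^sub>0 'k) set" where
  "tensor_null sV sW = module.span pm_scale (tensor_relators sV sW)"

type_synonym ('k, 'v, 'w) tensor = "('k, ('v \<times> 'w) \<Rightarrow>\<^sub>0 'k) quot"

definition tpure ::
  "('k::field \<Rightarrow> 'v::ab_group_add \<Rightarrow> 'v) \<Rightarrow> ('k \<Rightarrow> 'w::ab_group_add \<Rightarrow> 'w) \<Rightarrow>
   'v \<Rightarrow> 'w \<Rightarrow> ('k, 'v, 'w) tensor" where
  "tpure sV sW v w = qproj pm_scale (tensor_null sV sW) (Poly_Mapping.single (v, w) 1)"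

text \<open>
  For subspaces \<open>A\<close> of \<open>V\<close> and \<open>B\<close> of \<open>W\<close> the map \<open>A \<otimes> B \<rightarrow> V \<otimes> W\<close> is injective (we work over a
  field), so \<open>A \<otimes> B\<close> is identified with its image.
\<close>

definition tensor_space ::
  "('k::field \<Rightarrow> 'v::ab_group_add \<Rightarrow> 'v) \<Rightarrow> ('k \<Rightarrow> 'w::ab_group_add \<Rightarrow> 'w) \<Rightarrow>
   'v set \<Rightarrow> 'w set \<Rightarrow> ('k, 'v, 'w) tensor set" where
  "tensor_space sV sW A B = module.span qscale {tpure sV sW a b | a b. a \<in> A \<and> b \<in> B}"

text \<open>
  The linear map \<open>V \<otimes> W \<rightarrow> U\<close> induced by a bilinear map \<open>m\<close>: apply \<open>m\<close> termwise to a representing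
  formal sum.  In Sweedler notation, \<open>tlift sV sW sU m (\<Delta> c)\<close> is \<open>m c\<^sup>1 c\<^sup>2\<close>.
\<close>

definition free_lift :: "('k::field \<Rightarrow> 'u::ab_group_add \<Rightarrow> 'u) \<Rightarrow> ('x \<Rightarrow> 'u) \<Rightarrow> ('x \<Rightarrow>\<^sub>0 'k) \<Rightarrow> 'u" where
  "free_lift sU m x = (\<Sum>p\<in>Poly_Mapping.keys x. sU (Poly_Mapping.lookup x p) (m p))"

definition tlift ::
  "('k::field \<Rightarrow> 'v::ab_group_add \<Rightarrow> 'v) \<Rightarrow> ('k \<Rightarrow> 'w::ab_group_add \<Rightarrow> 'w) \<Rightarrow>
   ('k \<Rightarrow> 'u::ab_group_add \<Rightarrow> 'u) \<Rightarrow> ('v \<Rightarrow> 'w \<Rightarrow> 'u) \<Rightarrow> ('k, 'v, 'w) tensor \<Rightarrow> 'u" where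
  "tlift sV sW sU m t =
     free_lift sU (\<lambda>(v, w). m v w) (qrep pm_scale (tensor_null sV sW) t)"

lemma lookup_pm_scale [simp]: "Poly_Mapping.lookup (pm_scale a x) p = a * Poly_Mapping.lookup x p"
  by (simp add: pm_scale_def Poly_Mapping.map.rep_eq when_def)

lemma vector_space_pm_scale: "vector_space pm_scale"
  by standard (auto intro!: poly_mapping_eqI simp: lookup_add algebra_simps)

lemma linear_free_lift:
  assumes "vector_space sU"
  shows "Vector_Spaces.linear pm_scale sU (free_lift sU m)"
proof -
  interpret vector_space sU by fact
  have superset: "free_lift sU m x = (\<Sum>p\<in>K. sU (Poly_Mapping.lookup x p) (m p))"
    if "finite K" "Poly_Mapping.keys x \<subseteq> K" for x K
    unfolding free_lift_def
    by (rule sum.mono_neutral_left) (use that in \<open>auto simp: in_keys_iff\<close>)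
  have add: "free_lift sU m (x + y) = free_lift sU m x + free_lift sU m y" for x y
  proof -
    let ?K = "Poly_Mapping.keys x \<union> Poly_Mapping.keys y"
    have "Poly_Mapping.keys (x + y) \<subseteq> ?K"
      by (rule Poly_Mapping.keys_add)
    then show ?thesis
      by (simp add: superset[of ?K] lookup_add scale_left_distrib sum.distrib)
  qed
  have scale: "free_lift sU m (pm_scale a x) = sU a (free_lift sU m x)" for a x
  proof -
    have "Poly_Mapping.keys (pm_scale a x) \<subseteq> Poly_Mapping.keys x"
      by (auto simp: in_keys_iff)
    then show ?thesis
      by (simp add: superset[of "Poly_Mapping.keys x"] scale_sum_right)
  qed
  show ?thesis
    using assms vector_space_pm_scale add scale by (simp add: Vector_Spaces.linear_iff)
qed

lemma free_lift_single [simp]: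
  assumes "vector_space sU"
  shows "free_lift sU m (Poly_Mapping.single p 1) = m p"
proof -
  interpret vector_space sU by fact
  show ?thesis by (simp add: free_lift_def)
qed

lemma subspace_tensor_null:
  fixes sV :: "'a::field \<Rightarrow> 'b::ab_group_add \<Rightarrow> 'b" and sW :: "'a \<Rightarrow> 'c::ab_group_add \<Rightarrow> 'c"
  shows "module.subspace pm_scale (tensor_null sV sW)"
proof -
  interpret vector_space "pm_scale :: 'a \<Rightarrow> ('b \<times> 'c \<Rightarrow>\<^sub>0 'a) \<Rightarrow> _"
    by (rule vector_space_pm_scale)
  show ?thesis by (simp add: tensor_null_def)
qed

lemma bilinear_tpure:
  fixes sV :: "'a::field \<Rightarrow> 'b::ab_group_add \<Rightarrow> 'b" and sW :: "'a \<Rightarrow> 'c::ab_group_add \<Rightarrow> 'c"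
  assumes "vector_space sV" "vector_space sW"
  shows "bilinear_map sV sW qscale (tpure sV sW)"
proof -
  interpret f: vector_space "pm_scale :: 'a \<Rightarrow> ('b \<times> 'c \<Rightarrow>\<^sub>0 'a) \<Rightarrow> _"
    by (rule vector_space_pm_scale)
  let ?q = "qproj pm_scale (tensor_null sV sW)"
  let ?e = "\<lambda>v w. Poly_Mapping.single (v, w) 1"
  have lin: "Vector_Spaces.linear pm_scale qscale ?q"
    by (rule linear_qproj[OF vector_space_pm_scale])
  have add: "?q (x + y) = ?q x + ?q y" and scale: "?q (pm_scale a x) = qscale a (?q x)" for x y a
    using lin by (simp_all add: Vector_Spaces.linear_iff)
  have eqI: "?q x = ?q y" if "x - y \<in> tensor_relators sV sW" for x y
    unfolding qproj_eq_iff[OF vector_space_pm_scale subspace_tensor_null]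
    unfolding tensor_null_def by (rule f.span_base[OF that])
  have "?q (?e (v + v') w) = ?q (?e v w + ?e v' w)" for v v' w
    by (rule eqI, unfold tensor_relators_def Let_def diff_diff_eq) blast
  moreover have "?q (?e v (w + w')) = ?q (?e v w + ?e v w')" for v w w'
    by (rule eqI, unfold tensor_relators_def Let_def diff_diff_eq) blast
  moreover have "?q (?e (sV a v) w) = ?q (pm_scale a (?e v w))" for a v w
    by (rule eqI, unfold tensor_relators_def Let_def) blast
  moreover have "?q (?e v (sW a w)) = ?q (pm_scale a (?e v w))" for a v w
    by (rule eqI, unfold tensor_relators_def Let_def) blast
  ultimately show ?thesis
    using assms vector_space_qscale
    by (simp add: bilinear_map_def Vector_Spaces.linear_iff tpure_def add scale)
qed

lemma linear_tlift:
  assumes "vector_space sU"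
  shows "Vector_Spaces.linear qscale sU (tlift sV sW sU m)"
  using linear_free_lift[OF assms, of "\<lambda>(v, w). m v w"]
    qrep(1)[OF vector_space_pm_scale, of "tensor_null sV sW"] assms
  by (simp add: Vector_Spaces.linear_iff tlift_def)

lemma tlift_tpure:
  fixes sV :: "'a::field \<Rightarrow> 'b::ab_group_add \<Rightarrow> 'b" and sW :: "'a \<Rightarrow> 'c::ab_group_add \<Rightarrow> 'c"
  assumes "bilinear_map sV sW sU m"
  shows "tlift sV sW sU m (tpure sV sW v w) = m v w"
proof -
  have vs: "vector_space sU" "vector_space sV" "vector_space sW"
    using assms by (auto simp: bilinear_map_def Vector_Spaces.linear_iff)
  let ?F = "free_lift sU (\<lambda>(v, w). m v w)"
  let ?N = "tensor_null sV sW"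
  interpret f: vector_space "pm_scale :: 'a \<Rightarrow> ('b \<times> 'c \<Rightarrow>\<^sub>0 'a) \<Rightarrow> _"
    by (rule vector_space_pm_scale)
  interpret vector_space sU by fact
  interpret p: vector_space_pair "pm_scale :: 'a \<Rightarrow> ('b \<times> 'c \<Rightarrow>\<^sub>0 'a) \<Rightarrow> _" sU ..
  have lin: "Vector_Spaces.linear pm_scale sU ?F"
    by (rule linear_free_lift[OF vs(1)])
  have diff: "?F (x - y) = ?F x - ?F y" and scale: "?F (pm_scale a x) = sU a (?F x)" for x y a
    using p.linear_diff[OF lin] p.linear_scale[OF lin] by auto
  have "?F x = 0" if "x \<in> tensor_relators sV sW" for x
    using that assms
    by (auto simp: tensor_relators_def Let_def diff scale free_lift_single[OF vs(1)]
        bilinear_map_def Vector_Spaces.linear_iff)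
  then have null: "?F x = 0" if "x \<in> ?N" for x
    using p.linear_eq_0_on_span[OF lin] that unfolding tensor_null_def by blast
  let ?x = "Poly_Mapping.single (v, w) 1"
  have "qrep pm_scale ?N (qproj pm_scale ?N ?x) - ?x \<in> ?N"
    using qrep(2)[OF vector_space_pm_scale]
    by (simp add: qproj_eq_iff[OF vector_space_pm_scale subspace_tensor_null, symmetric])
  from null[OF this] show ?thesis
    by (simp add: diff tlift_def tpure_def free_lift_single[OF vs(1)])
qed

definition tmap ::
  "('k::field \<Rightarrow> 'v::ab_group_add \<Rightarrow> 'v) \<Rightarrow> ('k \<Rightarrow> 'w::ab_group_add \<Rightarrow> 'w) \<Rightarrow>
   ('k \<Rightarrow> 'x::ab_group_add \<Rightarrow> 'x) \<Rightarrow> ('k \<Rightarrow> 'y::ab_group_add \<Rightarrow> 'y) \<Rightarrow>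
   ('v \<Rightarrow> 'x) \<Rightarrow> ('w \<Rightarrow> 'y) \<Rightarrow> ('k, 'v, 'w) tensor \<Rightarrow> ('k, 'x, 'y) tensor" where
  "tmap sV sW sX sY f g = tlift sV sW qscale (\<lambda>v w. tpure sX sY (f v) (g w))"

text \<open>The linear map on \<open>(U \<otimes> V) \<otimes> W\<close> induced by a trilinear map.\<close>

definition tlift3 ::
  "('k::field \<Rightarrow> 'u::ab_group_add \<Rightarrow> 'u) \<Rightarrow> ('k \<Rightarrow> 'v::ab_group_add \<Rightarrow> 'v) \<Rightarrow>
   ('k \<Rightarrow> 'w::ab_group_add \<Rightarrow> 'w) \<Rightarrow> ('k \<Rightarrow> 'x::ab_group_add \<Rightarrow> 'x) \<Rightarrow>
   ('u \<Rightarrow> 'v \<Rightarrow> 'w \<Rightarrow> 'x) \<Rightarrow> ('k, ('k, 'u, 'v) tensor, 'w) tensor \<Rightarrow> 'x" where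
  "tlift3 sU sV sW sX m =
     tlift qscale sW sX (\<lambda>t w. tlift sU sV sX (\<lambda>u v. m u v w) t)"

definition tassoc ::
  "('k::field \<Rightarrow> 'u::ab_group_add \<Rightarrow> 'u) \<Rightarrow> ('k \<Rightarrow> 'v::ab_group_add \<Rightarrow> 'v) \<Rightarrow>
   ('k \<Rightarrow> 'w::ab_group_add \<Rightarrow> 'w) \<Rightarrow>
   ('k, ('k, 'u, 'v) tensor, 'w) tensor \<Rightarrow> ('k, 'u, ('k, 'v, 'w) tensor) tensor" where
  "tassoc sU sV sW = tlift3 sU sV sW qscale (\<lambda>u v w. tpure sU qscale u (tpure sV sW v w))"

section \<open>Coalgebras, Hopf algebras, module coalgebras\<close>

locale coalgebra = vector_space scale
  for scale :: "'k::field \<Rightarrow> 'c::ab_group_add \<Rightarrow> 'c" +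
  fixes comult :: "'c \<Rightarrow> ('k, 'c, 'c) tensor"
    and counit :: "'c \<Rightarrow> 'k"
  assumes comult_linear: "Vector_Spaces.linear scale qscale comult"
    and comult_in: "comult c \<in> tensor_space scale scale UNIV UNIV"
    and counit_linear: "Vector_Spaces.linear scale (*) counit"
    and coassoc: "tassoc scale scale scale (tmap scale scale qscale scale comult id (comult c)) =
                  tmap scale scale scale qscale id comult (comult c)"
    and counit_left: "tlift scale scale scale (\<lambda>x y. scale (counit x) y) (comult c) = c"
    and counit_right: "tlift scale scale scale (\<lambda>x y. scale (counit y) x) (comult c) = c"

definition comult2 ::
  "('k::field \<Rightarrow> 'c::ab_group_add \<Rightarrow> 'c) \<Rightarrow> ('c \<Rightarrow> ('k, 'c, 'c) tensor) \<Rightarrow>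
   'c \<Rightarrow> ('k, ('k, 'c, 'c) tensor, 'c) tensor" where
  "comult2 s \<Delta> c = tmap s s qscale s \<Delta> id (\<Delta> c)"

text \<open>The unit \<open>k \<rightarrow> H\<close> is \<open>a \<mapsto> scale a 1\<close>.\<close>

locale hopf_algebra = coalgebra scale comult counit
  for scale :: "'k::field \<Rightarrow> 'h::ring_1 \<Rightarrow> 'h"
    and comult :: "'h \<Rightarrow> ('k, 'h, 'h) tensor"
    and counit :: "'h \<Rightarrow> 'k" +
  fixes antipode :: "'h \<Rightarrow> 'h"
  assumes scale_mult_left: "scale a x * y = scale a (x * y)"
    and scale_mult_right: "x * scale a y = scale a (x * y)"
    and comult_mult: "comult (x * y) =
          tlift scale scale qscale (\<lambda>x1 x2.
            tlift scale scale qscale (\<lambda>y1 y2. tpure scale scale (x1 * y1) (x2 * y2)) (comult y))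
          (comult x)"
    and comult_one: "comult 1 = tpure scale scale 1 1"
    and counit_mult: "counit (x * y) = counit x * counit y"
    and counit_one: "counit 1 = 1"
    and antipode_linear: "Vector_Spaces.linear scale scale antipode"
    and antipode_left: "tlift scale scale scale (\<lambda>x y. antipode x * y) (comult h) = scale (counit h) 1"
    and antipode_right: "tlift scale scale scale (\<lambda>x y. x * antipode y) (comult h) = scale (counit h) 1"

definition right_module_coalgebra ::
  "('k::field \<Rightarrow> 'h::ring_1 \<Rightarrow> 'h) \<Rightarrow> ('h \<Rightarrow> ('k, 'h, 'h) tensor) \<Rightarrow> ('h \<Rightarrow> 'k) \<Rightarrow>
   ('k \<Rightarrow> 'c::ab_group_add \<Rightarrow> 'c) \<Rightarrow> ('c \<Rightarrow> ('k, 'c, 'c) tensor) \<Rightarrow> ('c \<Rightarrow> 'k) \<Rightarrow>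
   ('c \<Rightarrow> 'h \<Rightarrow> 'c) \<Rightarrow> bool" where
  "right_module_coalgebra sH \<Delta>H \<epsilon>H sC \<Delta>C \<epsilon>C act \<longleftrightarrow>
     coalgebra sC \<Delta>C \<epsilon>C \<and>
     bilinear_map sC sH sC act \<and>
     (\<forall>c. act c 1 = c) \<and>
     (\<forall>c g h. act (act c g) h = act c (g * h)) \<and>
     (\<forall>c h. \<Delta>C (act c h) =
        tlift sC sC qscale (\<lambda>c1 c2.
          tlift sH sH qscale (\<lambda>h1 h2. tpure sC sC (act c1 h1) (act c2 h2)) (\<Delta>H h)) (\<Delta>C c)) \<and>
     (\<forall>c h. \<epsilon>C (act c h) = \<epsilon>C c * \<epsilon>H h)"

section \<open>The quotient coalgebra and Hopf Galois coextensions\<close>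

definition coideal_I ::
  "('h \<Rightarrow> 'k::field) \<Rightarrow> ('k \<Rightarrow> 'c::ab_group_add \<Rightarrow> 'c) \<Rightarrow> ('c \<Rightarrow> 'h \<Rightarrow> 'c) \<Rightarrow> 'c set" where
  "coideal_I \<epsilon>H sC act = module.span sC {act c h - sC (\<epsilon>H h) c | c h. True}"

text \<open>The projection \<open>\<pi> : C \<rightarrow> D = C / I\<close>; the space \<open>D\<close> is \<open>range \<pi>\<close>.\<close>

definition proj_D ::
  "('h \<Rightarrow> 'k::field) \<Rightarrow> ('k \<Rightarrow> 'c::ab_group_add \<Rightarrow> 'c) \<Rightarrow> ('c \<Rightarrow> 'h \<Rightarrow> 'c) \<Rightarrow>
   'c \<Rightarrow> ('k, 'c) quot" where
  "proj_D \<epsilon>H sC act = qproj sC (coideal_I \<epsilon>H sC act)"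

text \<open>
  Linear functionals on a subspace \<open>A\<close>, as functions on the ambient type whose values outside \<open>A\<close>
  are irrelevant.
\<close>

definition dual_on :: "('k::field \<Rightarrow> 'v::ab_group_add \<Rightarrow> 'v) \<Rightarrow> 'v set \<Rightarrow> ('v \<Rightarrow> 'k) set" where
  "dual_on s A = {\<phi>. (\<forall>x\<in>A. \<forall>y\<in>A. \<phi> (x + y) = \<phi> x + \<phi> y) \<and> (\<forall>a. \<forall>x\<in>A. \<phi> (s a x) = a * \<phi> x)}"

text \<open>The subspace \<open>C\<^sup>D\<close> of \<open>C\<close>.\<close>

definition coinv_D ::
  "('h \<Rightarrow> 'k::field) \<Rightarrow> ('k \<Rightarrow> 'c::ab_group_add \<Rightarrow> 'c) \<Rightarrow> ('c \<Rightarrow> ('k, 'c, 'c) tensor) \<Rightarrow>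
   ('c \<Rightarrow> 'h \<Rightarrow> 'c) \<Rightarrow> 'c set" where
  "coinv_D \<epsilon>H sC \<Delta>C act =
     (let \<pi> = proj_D \<epsilon>H sC act in
      {c. \<forall>\<phi> \<in> dual_on qscale (range \<pi>).
            tlift sC sC sC (\<lambda>c1 c2. sC (\<phi> (\<pi> c2)) c1) (\<Delta>C c) =
            tlift sC sC sC (\<lambda>c1 c2. sC (\<phi> (\<pi> c1)) c2) (\<Delta>C c)})"

text \<open>
  \<open>C \<box>\<^sub>D C\<close>: the elements of \<open>C \<otimes> C\<close> on which \<open>\<rho>\<^sub>r \<otimes> id\<close> and \<open>id \<otimes> \<rho>\<^sub>l\<close> agree in
  \<open>C \<otimes> (D \<otimes> C)\<close>, for the \<open>D\<close>-coactions \<open>\<rho>\<^sub>r = (id \<otimes> \<pi>) \<Delta>\<close> and \<open>\<rho>\<^sub>l = (\<pi> \<otimes> id) \<Delta>\<close>.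
\<close>

definition cotensor_D ::
  "('h \<Rightarrow> 'k::field) \<Rightarrow> ('k \<Rightarrow> 'c::ab_group_add \<Rightarrow> 'c) \<Rightarrow> ('c \<Rightarrow> ('k, 'c, 'c) tensor) \<Rightarrow>
   ('c \<Rightarrow> 'h \<Rightarrow> 'c) \<Rightarrow> ('k, 'c, 'c) tensor set" where
  "cotensor_D \<epsilon>H sC \<Delta>C act =
     (let \<pi> = proj_D \<epsilon>H sC act;
          \<rho>r = (\<lambda>c. tmap sC sC sC qscale id \<pi> (\<Delta>C c));
          \<rho>l = (\<lambda>c. tmap sC sC qscale sC \<pi> id (\<Delta>C c))
      in {t \<in> tensor_space sC sC UNIV UNIV.
            tassoc sC qscale sC (tmap sC sC qscale sC \<rho>r id t) = tmap sC sC sC qscale id \<rho>l t})"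

definition can_map ::
  "('k::field \<Rightarrow> 'h::ring_1 \<Rightarrow> 'h) \<Rightarrow> ('k \<Rightarrow> 'c::ab_group_add \<Rightarrow> 'c) \<Rightarrow>
   ('c \<Rightarrow> ('k, 'c, 'c) tensor) \<Rightarrow> ('c \<Rightarrow> 'h \<Rightarrow> 'c) \<Rightarrow> ('k, 'c, 'h) tensor \<Rightarrow> ('k, 'c, 'c) tensor" where
  "can_map sH sC \<Delta>C act =
     tlift sC sH qscale (\<lambda>c h. tlift sC sC qscale (\<lambda>c1 c2. tpure sC sC c1 (act c2 h)) (\<Delta>C c))"

definition hopf_galois_coextension ::
  "('k::field \<Rightarrow> 'h::ring_1 \<Rightarrow> 'h) \<Rightarrow> ('h \<Rightarrow> ('k, 'h, 'h) tensor) \<Rightarrow> ('h \<Rightarrow> 'k) \<Rightarrow>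
   ('k \<Rightarrow> 'c::ab_group_add \<Rightarrow> 'c) \<Rightarrow> ('c \<Rightarrow> ('k, 'c, 'c) tensor) \<Rightarrow> ('c \<Rightarrow> 'k) \<Rightarrow>
   ('c \<Rightarrow> 'h \<Rightarrow> 'c) \<Rightarrow> bool" where
  "hopf_galois_coextension sH \<Delta>H \<epsilon>H sC \<Delta>C \<epsilon>C act \<longleftrightarrow>
     right_module_coalgebra sH \<Delta>H \<epsilon>H sC \<Delta>C \<epsilon>C act \<and>
     bij_betw (can_map sH sC \<Delta>C act) (tensor_space sC sH UNIV UNIV) (cotensor_D \<epsilon>H sC \<Delta>C act)"

definition total_cointegral ::
  "('k::field \<Rightarrow> 'h::ring_1 \<Rightarrow> 'h) \<Rightarrow> ('h \<Rightarrow> 'k) \<Rightarrow> ('k \<Rightarrow> 'c::ab_group_add \<Rightarrow> 'c) \<Rightarrow>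
   ('c \<Rightarrow> 'k) \<Rightarrow> ('c \<Rightarrow> 'h \<Rightarrow> 'c) \<Rightarrow> ('c \<Rightarrow> 'h) \<Rightarrow> bool" where
  "total_cointegral sH \<epsilon>H sC \<epsilon>C act f \<longleftrightarrow>
     Vector_Spaces.linear sC sH f \<and> (\<forall>c. \<epsilon>H (f c) = \<epsilon>C c) \<and> (\<forall>c h. f (act c h) = f c * h)"

text \<open>\<open>g\<close> is the (necessarily unique) inverse of \<open>f\<close> in the convolution algebra \<open>Hom(C, H)\<close>.\<close>

definition is_convolution_inverse ::
  "('k::field \<Rightarrow> 'h::ring_1 \<Rightarrow> 'h) \<Rightarrow> ('k \<Rightarrow> 'c::ab_group_add \<Rightarrow> 'c) \<Rightarrow>
   ('c \<Rightarrow> ('k, 'c, 'c) tensor) \<Rightarrow> ('c \<Rightarrow> 'k) \<Rightarrow> ('c \<Rightarrow> 'h) \<Rightarrow> ('c \<Rightarrow> 'h) \<Rightarrow> bool" where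
  "is_convolution_inverse sH sC \<Delta>C \<epsilon>C f g \<longleftrightarrow>
     Vector_Spaces.linear sC sH g \<and>
     (\<forall>c. tlift sC sC sH (\<lambda>c1 c2. f c1 * g c2) (\<Delta>C c) = sH (\<epsilon>C c) 1) \<and>
     (\<forall>c. tlift sC sC sH (\<lambda>c1 c2. g c1 * f c2) (\<Delta>C c) = sH (\<epsilon>C c) 1)"

text \<open>The map \<open>c \<mapsto> f\<inverse>(c\<^sup>3) f(c\<^sup>1) \<otimes> c\<^sup>2\<close>, with \<open>g\<close> in the role of \<open>f\<inverse>\<close>.\<close>

definition cleft_coaction ::
  "('k::field \<Rightarrow> 'h::ring_1 \<Rightarrow> 'h) \<Rightarrow> ('k \<Rightarrow> 'c::ab_group_add \<Rightarrow> 'c) \<Rightarrow>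
   ('c \<Rightarrow> ('k, 'c, 'c) tensor) \<Rightarrow> ('c \<Rightarrow> 'h) \<Rightarrow> ('c \<Rightarrow> 'h) \<Rightarrow> 'c \<Rightarrow> ('k, 'h, 'c) tensor" where
  "cleft_coaction sH sC \<Delta>C f g c =
     tlift3 sC sC sC qscale (\<lambda>c1 c2 c3. tpure sH sC (g c3 * f c1) c2) (comult2 sC \<Delta>C c)"

section \<open>Stable anti Yetter-Drinfeld modules\<close>

text \<open>
  The underlying space of a module or comodule is a subspace \<open>M\<close> of an ambient space \<open>V\<close>; the
  structure maps are linear on \<open>V\<close>, and restrict to \<open>M \<otimes> H \<rightarrow> M\<close> and \<open>M \<rightarrow> H \<otimes> M\<close>.
\<close>

definition right_module_on ::
  "('k::field \<Rightarrow> 'h::ring_1 \<Rightarrow> 'h) \<Rightarrow> ('k \<Rightarrow> 'v::ab_group_add \<Rightarrow> 'v) \<Rightarrow> 'v set \<Rightarrow>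
   ('v \<Rightarrow> 'h \<Rightarrow> 'v) \<Rightarrow> bool" where
  "right_module_on sH sV M act \<longleftrightarrow>
     module.subspace sV M \<and> bilinear_map sV sH sV act \<and>
     (\<forall>m\<in>M. \<forall>h. act m h \<in> M) \<and>
     (\<forall>m\<in>M. act m 1 = m) \<and>
     (\<forall>m\<in>M. \<forall>g h. act (act m g) h = act m (g * h))"

definition left_comodule_on ::
  "('k::field \<Rightarrow> 'h::ring_1 \<Rightarrow> 'h) \<Rightarrow> ('h \<Rightarrow> ('k, 'h, 'h) tensor) \<Rightarrow> ('h \<Rightarrow> 'k) \<Rightarrow>
   ('k \<Rightarrow> 'v::ab_group_add \<Rightarrow> 'v) \<Rightarrow> 'v set \<Rightarrow> ('v \<Rightarrow> ('k, 'h, 'v) tensor) \<Rightarrow> bool" where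
  "left_comodule_on sH \<Delta>H \<epsilon>H sV M \<rho> \<longleftrightarrow>
     module.subspace sV M \<and> Vector_Spaces.linear sV qscale \<rho> \<and>
     (\<forall>m\<in>M. \<rho> m \<in> tensor_space sH sV UNIV M) \<and>
     (\<forall>m\<in>M. tassoc sH sH sV (tmap sH sV qscale sV \<Delta>H id (\<rho> m)) =
             tmap sH sV sH qscale id \<rho> (\<rho> m)) \<and>
     (\<forall>m\<in>M. tlift sH sV sV (\<lambda>h v. sV (\<epsilon>H h) v) (\<rho> m) = m)"

definition anti_yetter_drinfeld ::
  "('k::field \<Rightarrow> 'h::ring_1 \<Rightarrow> 'h) \<Rightarrow> ('h \<Rightarrow> ('k, 'h, 'h) tensor) \<Rightarrow> ('h \<Rightarrow> 'k) \<Rightarrow> ('h \<Rightarrow> 'h) \<Rightarrow>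
   ('k \<Rightarrow> 'v::ab_group_add \<Rightarrow> 'v) \<Rightarrow> 'v set \<Rightarrow> ('v \<Rightarrow> 'h \<Rightarrow> 'v) \<Rightarrow>
   ('v \<Rightarrow> ('k, 'h, 'v) tensor) \<Rightarrow> bool" where
  "anti_yetter_drinfeld sH \<Delta>H \<epsilon>H S sV M act \<rho> \<longleftrightarrow>
     right_module_on sH sV M act \<and>
     left_comodule_on sH \<Delta>H \<epsilon>H sV M \<rho> \<and>
     (\<forall>m\<in>M. \<forall>h. \<rho> (act m h) =
        tlift3 sH sH sH qscale (\<lambda>h1 h2 h3.
          tlift sH sV qscale (\<lambda>x y. tpure sH sV (S h3 * x * h1) (act y h2)) (\<rho> m))
        (comult2 sH \<Delta>H h))"

definition stable_on ::
  "('k::field \<Rightarrow> 'h::ring_1 \<Rightarrow> 'h) \<Rightarrow> ('k \<Rightarrow> 'v::ab_group_add \<Rightarrow> 'v) \<Rightarrow> 'v set \<Rightarrow>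
   ('v \<Rightarrow> 'h \<Rightarrow> 'v) \<Rightarrow> ('v \<Rightarrow> ('k, 'h, 'v) tensor) \<Rightarrow> bool" where
  "stable_on sH sV M act \<rho> \<longleftrightarrow> (\<forall>m\<in>M. tlift sH sV sV (\<lambda>x y. act y x) (\<rho> m) = m)"

end

theory Submission
  imports Defs
begin

text \<open>
  Write \<open>g\<close> for the convolution inverse of \<open>f\<close> and \<open>a \<otimes> m\<close> (a sum being understood) for the coaction
  \<open>g(c\<^sup>3) f(c\<^sup>1) \<otimes> c\<^sup>2\<close>.  The proof rests on one identity, \<open>coaction_can\<close>: for \<open>c\<close> in \<open>C\<^sup>D\<close>,

    \<open>m\<^sup>1 \<otimes> m\<^sup>2 a = c\<^sup>2 \<otimes> c\<^sup>1\<close>   in \<open>C \<otimes> C\<close>,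

  that is, the flipped coaction is the preimage of \<open>c\<^sup>2 \<otimes> c\<^sup>1\<close> under the canonical map
  \<open>x \<otimes> h \<mapsto> x\<^sup>1 \<otimes> x\<^sup>2 h\<close>.  It holds because the map \<open>r(c) = c\<^sup>1 g(c\<^sup>2)\<close> factors through \<open>D\<close>, so that
  membership in \<open>C\<^sup>D\<close> gives \<open>c\<^sup>1 \<otimes> r(c\<^sup>2) = c\<^sup>2 \<otimes> r(c\<^sup>1)\<close>, and because \<open>r(c\<^sup>1) f(c\<^sup>2) = c\<close>.  That
  \<open>r\<close> factors through \<open>D\<close> is a consequence of \<open>g(c h) = S(h) g(c)\<close> (\<open>g_act\<close>), which holds by
  uniqueness of inverses in the convolution algebra of \<open>C \<otimes> H\<close>.

  Stability is the identity with \<open>\<epsilon>\<close> applied to its first leg.  The two main properties of the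
  coaction, that it takes values in \<open>H \<otimes> C\<^sup>D\<close> and that it is coassociative, involve expressions in
  \<open>a\<close> and \<open>m\<close> which can be recovered from \<open>m\<^sup>1 \<otimes> m\<^sup>2 a\<close>, since \<open>x\<^sup>1 \<otimes> g(x\<^sup>2) f(x\<^sup>3 h) = x \<otimes> h\<close>
  (\<open>can_inverse\<close>).  So the required equations can be rewritten by means of the identity, after
  which their sides differ only by coassociativity of \<open>C\<close>.  The anti Yetter-Drinfeld condition follows
  directly from \<open>f(c h) = f(c) h\<close> and \<open>g(c h) = S(h) g(c)\<close>.

  All computations are with Sweedler sums \<open>tlift s s U m (\<Delta> c)\<close>, nested to express iterated
  coproducts.  Equations in tensor products with \<open>D\<close> are tested against functionals on
  \<open>D\<close>, regarded as \<open>H\<close>-invariant functionals on \<open>C\<close>.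
\<close>

section \<open>Linear maps\<close>

text \<open>
  Each of these rules peels the outermost operation off an expression in which the variable occurs
  once, so that \<open>intro lin\<close> proves linearity of multilinear expressions in each of their variables.
\<close>

named_theorems lin

lemma linear_vector_space:
  assumes "Vector_Spaces.linear s t F"
  shows "vector_space s" "vector_space t"
  using assms by (auto simp: Vector_Spaces.linear_iff)

lemma linear_ident [lin]:
  assumes "vector_space s"
  shows "Vector_Spaces.linear s s (\<lambda>x. x)"
  using assms by (simp add: Vector_Spaces.linear_iff)

lemma linear_comp:
  assumes "Vector_Spaces.linear s t F" "Vector_Spaces.linear r s p"
  shows "Vector_Spaces.linear r t (\<lambda>x. F (p x))"
  using assms by (simp add: Vector_Spaces.linear_iff)

lemma linear_minus:
  assumes "Vector_Spaces.linear s t F" "Vector_Spaces.linear s t G"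
  shows "Vector_Spaces.linear s t (\<lambda>x. F x - G x)"
proof -
  interpret vector_space t by (rule linear_vector_space(2)[OF assms(1)])
  show ?thesis
    using assms by (simp add: Vector_Spaces.linear_iff scale_right_diff_distrib)
qed

lemma linear_sum:
  assumes "Vector_Spaces.linear s t F"
  shows "F (\<Sum>i\<in>I. x i) = (\<Sum>i\<in>I. F (x i))"
proof -
  interpret Vector_Spaces.linear s t F by fact
  show ?thesis by (rule sum)
qed

lemma linear_scale:
  assumes "Vector_Spaces.linear s t F"
  shows "F (s a x) = t a (F x)"
  using assms by (simp add: Vector_Spaces.linear_iff)

lemma linear_diff:
  assumes "Vector_Spaces.linear s t F"
  shows "F (x - y) = F x - F y"
proof -
  interpret Vector_Spaces.linear s t F by fact
  show ?thesis by (rule diff)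
qed

lemma linear_scale_left [lin]:
  assumes "vector_space t" "Vector_Spaces.linear s (*) p"
  shows "Vector_Spaces.linear s t (\<lambda>x. t (p x) u)"
proof -
  interpret vector_space t by fact
  show ?thesis
    using assms by (simp add: Vector_Spaces.linear_iff scale_left_distrib)
qed

lemma linear_scale_right [lin]:
  assumes "Vector_Spaces.linear s t p"
  shows "Vector_Spaces.linear s t (\<lambda>x. t a (p x))"
proof -
  interpret vector_space t by (rule linear_vector_space(2)[OF assms])
  show ?thesis
    using assms by (simp add: Vector_Spaces.linear_iff scale_right_distrib mult.commute)
qed

lemma linear_bilinear_left:
  assumes "bilinear_map sV sW sU m" "Vector_Spaces.linear s sV p"
  shows "Vector_Spaces.linear s sU (\<lambda>x. m (p x) w)"
  using assms linear_comp[of sV sU "\<lambda>v. m v w" s p] by (simp add: bilinear_map_def)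

lemma linear_bilinear_right:
  assumes "bilinear_map sV sW sU m" "Vector_Spaces.linear s sW p"
  shows "Vector_Spaces.linear s sU (\<lambda>x. m v (p x))"
  using assms linear_comp[of sW sU "m v" s p] by (simp add: bilinear_map_def)

lemma bilinear_vector_space:
  assumes "bilinear_map sV sW sU m"
  shows "vector_space sU"
  using assms by (auto simp: bilinear_map_def Vector_Spaces.linear_iff)

section \<open>Maps out of tensor products\<close>

lemma vector_space_quot [lin]: "vector_space qscale"
  by (rule vector_space_qscale)

lemma vector_space_ground [lin]: "vector_space (*)"
  by (rule vector_space_field)

text \<open>
  \<open>tlift\<close> is a finite sum over a representing formal sum, whose terms and coefficients do not depend
  on the map.  Consequently a linear map may be pulled into \<open>tlift\<close>, and two such sums may be
  exchanged, for an arbitrary map in place of a bilinear one.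
\<close>

lemma linear_tlift_commute:
  assumes "Vector_Spaces.linear sU sX F"
  shows "F (tlift sV sW sU m t) = tlift sV sW sX (\<lambda>v w. F (m v w)) t"
  by (simp add: tlift_def free_lift_def case_prod_beta linear_sum[OF assms] linear_scale[OF assms])

lemma linear_tlift_tensor [lin]:
  assumes "vector_space sU" "Vector_Spaces.linear s qscale p"
  shows "Vector_Spaces.linear s sU (\<lambda>x. tlift sV sW sU m (p x))"
  by (rule linear_comp[OF linear_tlift[OF assms(1)] assms(2)])

lemma linear_tlift_map [lin]:
  assumes "\<And>v w. Vector_Spaces.linear s sU (\<lambda>x. m x v w)"
  shows "Vector_Spaces.linear s sU (\<lambda>x. tlift sV sW sU (m x) t)"
proof -
  interpret vector_space sU by (rule linear_vector_space(2)[OF assms])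
  have "sU a (tlift sV sW sU n t) = tlift sV sW sU (\<lambda>v w. sU a (n v w)) t" for a n
    by (rule linear_tlift_commute, rule linear_scale_right, rule linear_ident) unfold_locales
  then show ?thesis
    using assms
    by (simp add: Vector_Spaces.linear_iff)
       (simp add: tlift_def free_lift_def case_prod_beta scale_right_distrib sum.distrib)
qed

lemma tlift_swap:
  assumes "vector_space sU"
  shows "tlift sV sW sU (\<lambda>v w. tlift sX sY sU (\<lambda>x y. m v w x y) t') t =
         tlift sX sY sU (\<lambda>x y. tlift sV sW sU (\<lambda>v w. m v w x y) t) t'"
proof -
  interpret vector_space sU by fact
  show ?thesis
    by (simp add: tlift_def free_lift_def case_prod_beta scale_sum_right mult.commute)
       (rule sum.swap)
qed

lemma tlift_tpure_id:
  assumes "vector_space sV" "vector_space sW" "t \<in> tensor_space sV sW A B"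
  shows "tlift sV sW qscale (tpure sV sW) t = t"
proof -
  interpret q: vector_space "qscale :: 'a \<Rightarrow> ('a, 'b \<times> 'c \<Rightarrow>\<^sub>0 'a) quot \<Rightarrow> _"
    by (rule vector_space_qscale)
  interpret p: vector_space_pair "qscale :: 'a \<Rightarrow> ('a, 'b \<times> 'c \<Rightarrow>\<^sub>0 'a) quot \<Rightarrow> _"
    "qscale :: 'a \<Rightarrow> ('a, 'b \<times> 'c \<Rightarrow>\<^sub>0 'a) quot \<Rightarrow> _" ..
  have bil: "bilinear_map sV sW qscale (tpure sV sW)"
    by (rule bilinear_tpure[OF assms(1,2)])
  show ?thesis
    using assms(3) unfolding tensor_space_def
    by (rule p.linear_eq_on[OF linear_tlift[OF vector_space_qscale] linear_ident[OF vector_space_qscale]])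
       (auto simp: tlift_tpure[OF bil])
qed


lemma tensor_space_eqI:
  assumes t: "t \<in> tensor_space sV sW A B"
    and m: "bilinear_map sV sW sU m" and n: "bilinear_map sV sW sU n"
    and eq: "\<And>a b. a \<in> A \<Longrightarrow> b \<in> B \<Longrightarrow> m a b = n a b"
  shows "tlift sV sW sU m t = tlift sV sW sU n t"
proof -
  have vs: "vector_space sU"
    using m by (auto simp: bilinear_map_def Vector_Spaces.linear_iff)
  interpret q: vector_space "qscale :: 'a \<Rightarrow> ('a, 'b \<times> 'c \<Rightarrow>\<^sub>0 'a) quot \<Rightarrow> _"
    by (rule vector_space_qscale)
  interpret u: vector_space sU by fact
  interpret p: vector_space_pair "qscale :: 'a \<Rightarrow> ('a, 'b \<times> 'c \<Rightarrow>\<^sub>0 'a) quot \<Rightarrow> _" sU ..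
  show ?thesis
    using t unfolding tensor_space_def
    by (rule p.linear_eq_on[OF linear_tlift[OF vs] linear_tlift[OF vs]])
       (auto simp: tlift_tpure[OF m] tlift_tpure[OF n] eq)
qed

lemma bilinear_mapI:
  assumes "\<And>w. Vector_Spaces.linear sV sU (\<lambda>v. m v w)" "\<And>v. Vector_Spaces.linear sW sU (\<lambda>w. m v w)"
  shows "bilinear_map sV sW sU m"
  using assms by (simp add: bilinear_map_def)

lemma tlift3_tmap:
  assumes "\<And>a b. Vector_Spaces.linear sZ sU (\<lambda>z. m a b z)"
  shows "tlift3 sA sB sZ sU m (tmap sX sZ qscale sZ F id t) =
         tlift sX sZ sU (\<lambda>x z. tlift sA sB sU (\<lambda>a b. m a b z) (F x)) t"
proof -
  have vs: "vector_space sU"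
    by (rule linear_vector_space(2)[OF assms])
  have bil: "bilinear_map qscale sZ sU (\<lambda>t' z. tlift sA sB sU (\<lambda>a b. m a b z) t')"
    by (intro bilinear_mapI linear_tlift_tensor linear_ident vector_space_quot linear_tlift_map assms vs)
  show ?thesis
    unfolding tlift3_def tmap_def
    by (subst linear_tlift_commute[OF linear_tlift[OF vs]]) (simp add: tlift_tpure[OF bil])
qed

lemma linear_tpure_left [lin]:
  assumes "vector_space sW" "Vector_Spaces.linear s sV p"
  shows "Vector_Spaces.linear s qscale (\<lambda>x. tpure sV sW (p x) w)"
  by (rule linear_bilinear_left[OF bilinear_tpure assms(2)])
    (use assms linear_vector_space in auto)

lemma linear_tpure_right [lin]:
  assumes "vector_space sV" "Vector_Spaces.linear s sW p"
  shows "Vector_Spaces.linear s qscale (\<lambda>x. tpure sV sW v (p x))"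
  by (rule linear_bilinear_right[OF bilinear_tpure assms(2)])
    (use assms linear_vector_space in auto)

lemma tassoc_tmap:
  assumes "vector_space sA" "vector_space sB" "vector_space sZ"
  shows "tassoc sA sB sZ (tmap sX sZ qscale sZ F id t) =
         tlift sX sZ qscale (\<lambda>x z. tlift sA sB qscale (\<lambda>a b. tpure sA qscale a (tpure sB sZ b z)) (F x)) t"
  unfolding tassoc_def by (rule tlift3_tmap) (intro lin assms)

section \<open>Coordinates in tensor products\<close>

lemma finite_coordinates:
  fixes s :: "'k::field \<Rightarrow> 'v::ab_group_add \<Rightarrow> 'v"
  assumes "vector_space s" "finite A"
  shows "\<exists>B \<beta>. (\<forall>b. Vector_Spaces.linear s (*) (\<beta> b)) \<and> (\<forall>v\<in>A. (\<Sum>b\<in>B. s (\<beta> b v) b) = v)"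
proof -
  interpret vector_space s by fact
  define E where "E = extend_basis {}"
  have E: "independent E" "\<And>v. v \<in> span E"
    unfolding E_def by (simp_all add: independent_extend_basis span_extend_basis independent_empty)
  define B where "B = (\<Union>v\<in>A. {b. representation E v b \<noteq> 0})"
  have fin: "finite B"
    unfolding B_def using assms(2) by (auto simp: finite_representation)
  show ?thesis
  proof (intro exI[of _ B] exI[of _ "\<lambda>b v. representation E v b"] conjI allI ballI)
    show "Vector_Spaces.linear s (*) (\<lambda>v. representation E v b)" for b
      using E vector_space_field
      by (simp add: Vector_Spaces.linear_iff representation_add representation_scale vector_space_axioms)
    show "(\<Sum>b\<in>B. s (representation E v b) b) = v" if "v \<in> A" for v
    proof -
      have "(\<Sum>b\<in>B. s (representation E v b) b) = (\<Sum>b | representation E v b \<noteq> 0. s (representation E v b) b)"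
        by (rule sum.mono_neutral_right[OF fin]) (use that in \<open>auto simp: B_def\<close>)
      then show ?thesis
        using sum_nonzero_representation_eq[OF E(1) E(2)] by simp
    qed
  qed
qed

text \<open>
  The pairs occurring in the formal sum that \<open>tlift\<close> evaluates.  As they are finitely many, only
  finitely many coordinates with respect to a basis of one factor matter for a given tensor.
\<close>

definition tensor_terms ::
  "('k::field \<Rightarrow> 'v::ab_group_add \<Rightarrow> 'v) \<Rightarrow> ('k \<Rightarrow> 'w::ab_group_add \<Rightarrow> 'w) \<Rightarrow>
   ('k, 'v, 'w) tensor \<Rightarrow> ('v \<times> 'w) set" where
  "tensor_terms sV sW t = Poly_Mapping.keys (qrep pm_scale (tensor_null sV sW) t)"

lemma finite_tensor_terms: "finite (tensor_terms sV sW t)"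
  by (simp add: tensor_terms_def)

lemma tlift_cong:
  assumes "\<And>v w. (v, w) \<in> tensor_terms sV sW t \<Longrightarrow> m v w = n v w"
  shows "tlift sV sW sU m t = tlift sV sW sU n t"
  unfolding tlift_def free_lift_def by (rule sum.cong) (use assms in \<open>auto simp: tensor_terms_def\<close>)

lemma tlift_sum:
  assumes "vector_space sU"
  shows "tlift sV sW sU (\<lambda>v w. \<Sum>b\<in>B. m b v w) t = (\<Sum>b\<in>B. tlift sV sW sU (m b) t)"
proof -
  interpret vector_space sU by fact
  show ?thesis
    by (simp add: tlift_def free_lift_def case_prod_beta scale_sum_right) (rule sum.swap)
qed

text \<open>
  Expanding \<open>Q v w\<close> in coordinates moves them onto the first argument of \<open>m\<close>, where the sum over the
  tensor can be carried out before \<open>m\<close> is applied.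
\<close>

lemma tlift_expand_coordinates:
  assumes m: "bilinear_map sX sY sU m"
    and \<beta>: "\<And>v w. (v, w) \<in> tensor_terms sV sW t \<Longrightarrow> (\<Sum>b\<in>B. sY (\<beta> b (Q v w)) b) = Q v w"
  shows "tlift sV sW sU (\<lambda>v w. m (P v w) (Q v w)) t =
         (\<Sum>b\<in>B. m (tlift sV sW sX (\<lambda>v w. sX (\<beta> b (Q v w)) (P v w)) t) b)"
proof -
  have m_lin: "Vector_Spaces.linear sX sU (\<lambda>x. m x y)" "Vector_Spaces.linear sY sU (m x)" for x y
    using m by (simp_all add: bilinear_map_def)
  have "m (P v w) (Q v w) = (\<Sum>b\<in>B. m (sX (\<beta> b (Q v w)) (P v w)) b)"
    if "(v, w) \<in> tensor_terms sV sW t" for v w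
    using linear_sum[OF m_lin(2), of "P v w" "\<lambda>b. sY (\<beta> b (Q v w)) b" B] \<beta>[OF that]
    by (simp add: linear_scale[OF m_lin(1)] linear_scale[OF m_lin(2)])
  then have "tlift sV sW sU (\<lambda>v w. m (P v w) (Q v w)) t =
      tlift sV sW sU (\<lambda>v w. \<Sum>b\<in>B. m (sX (\<beta> b (Q v w)) (P v w)) b) t"
    by (rule tlift_cong)
  also have "\<dots> = (\<Sum>b\<in>B. m (tlift sV sW sX (\<lambda>v w. sX (\<beta> b (Q v w)) (P v w)) t) b)"
    by (simp add: tlift_sum[OF linear_vector_space(2)[OF m_lin(1)]] linear_tlift_commute[OF m_lin(1)])
  finally show ?thesis .
qed

text \<open>
  Taking \<open>m\<close> to be \<open>\<otimes>\<close>, this says that the maps \<open>id \<otimes> \<beta>\<close> for functionals \<open>\<beta>\<close> separate the elements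
  of a tensor product.
\<close>

lemma tlift_eq_by_functionals:
  assumes m: "bilinear_map sX sY sU m"
    and eq: "\<And>\<beta>. Vector_Spaces.linear sY (*) \<beta> \<Longrightarrow>
      tlift sV sW sX (\<lambda>v w. sX (\<beta> (Q v w)) (P v w)) t =
      tlift sV sW sX (\<lambda>v w. sX (\<beta> (Q' v w)) (P' v w)) t"
  shows "tlift sV sW sU (\<lambda>v w. m (P v w) (Q v w)) t = tlift sV sW sU (\<lambda>v w. m (P' v w) (Q' v w)) t"
proof -
  have sY: "vector_space sY"
    using m by (auto simp: bilinear_map_def Vector_Spaces.linear_iff)
  let ?A = "(\<lambda>(v, w). Q v w) ` tensor_terms sV sW t \<union> (\<lambda>(v, w). Q' v w) ` tensor_terms sV sW t"
  have "finite ?A"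
    by (simp add: finite_tensor_terms)
  then obtain B \<beta> where \<beta>: "\<And>b. Vector_Spaces.linear sY (*) (\<beta> b)"
      "\<And>y. y \<in> ?A \<Longrightarrow> (\<Sum>b\<in>B. sY (\<beta> b y) b) = y"
    using finite_coordinates[OF sY] by meson
  have "(\<Sum>b\<in>B. sY (\<beta> b (Q v w)) b) = Q v w" "(\<Sum>b\<in>B. sY (\<beta> b (Q' v w)) b) = Q' v w"
    if "(v, w) \<in> tensor_terms sV sW t" for v w
    using that by (intro \<beta>(2), force)+
  then show ?thesis
    by (simp add: tlift_expand_coordinates[OF m, where B = B and \<beta> = \<beta>] eq[OF \<beta>(1)])
qed

text \<open>
  If \<open>t = \<Sum>\<^sub>b b \<otimes> y\<^sub>b\<close> with \<open>b\<close> running over a basis, then \<open>y\<^sub>b = (\<beta>\<^sub>b \<otimes> id) t\<close> for the coordinate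
  functional \<open>\<beta>\<^sub>b\<close>.
\<close>

lemma tensor_space_by_functionals:
  assumes "vector_space sV" "vector_space sW" and t: "t \<in> tensor_space sV sW UNIV UNIV"
    and M: "\<And>\<beta>. Vector_Spaces.linear sV (*) \<beta> \<Longrightarrow> tlift sV sW sW (\<lambda>v w. sW (\<beta> v) w) t \<in> M"
  shows "t \<in> tensor_space sV sW UNIV M"
proof -
  interpret q: vector_space "qscale :: 'a \<Rightarrow> ('a, 'b \<times> 'c \<Rightarrow>\<^sub>0 'a) quot \<Rightarrow> _"
    by (rule vector_space_qscale)
  have "finite (fst ` tensor_terms sV sW t)"
    by (simp add: finite_tensor_terms)
  then obtain B \<beta> where \<beta>: "\<And>b. Vector_Spaces.linear sV (*) (\<beta> b)"
      "\<And>v. v \<in> fst ` tensor_terms sV sW t \<Longrightarrow> (\<Sum>b\<in>B. sV (\<beta> b v) b) = v"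
    using finite_coordinates[OF assms(1)] by meson
  have bil: "bilinear_map sW sV qscale (\<lambda>w v. tpure sV sW v w)"
    by (intro bilinear_mapI lin assms)
  have "t = tlift sV sW qscale (\<lambda>v w. tpure sV sW v w) t"
    using tlift_tpure_id[OF assms(1-3)] by simp
  also have "\<dots> = (\<Sum>b\<in>B. tpure sV sW b (tlift sV sW sW (\<lambda>v w. sW (\<beta> b v) w) t))"
    by (rule tlift_expand_coordinates[OF bil]) (intro \<beta>(2), force)
  also have "\<dots> \<in> tensor_space sV sW UNIV M"
    unfolding tensor_space_def by (rule q.span_sum, rule q.span_base) (auto intro!: M[OF \<beta>(1)])
  finally show ?thesis .
qed

section \<open>Sweedler sums\<close>

context coalgebra
begin

abbreviation sweedler :: "('k \<Rightarrow> 'u::ab_group_add \<Rightarrow> 'u) \<Rightarrow> 'c \<Rightarrow> ('c \<Rightarrow> 'c \<Rightarrow> 'u) \<Rightarrow> 'u" where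
  "sweedler sU c m \<equiv> tlift scale scale sU m (comult c)"

lemma vector_space_scale [lin]: "vector_space scale"
  by (rule vector_space_axioms)

lemma linear_comult [lin]:
  "Vector_Spaces.linear s scale p \<Longrightarrow> Vector_Spaces.linear s qscale (\<lambda>x. comult (p x))"
  by (rule linear_comp[OF comult_linear])

lemma linear_counit [lin]:
  "Vector_Spaces.linear s scale p \<Longrightarrow> Vector_Spaces.linear s (*) (\<lambda>x. counit (p x))"
  by (rule linear_comp[OF counit_linear])

lemma sweedler_coassoc:
  assumes "\<And>y z. Vector_Spaces.linear scale sU (\<lambda>x. m x y z)"
    and "\<And>x z. Vector_Spaces.linear scale sU (\<lambda>y. m x y z)"
    and "\<And>x y. Vector_Spaces.linear scale sU (\<lambda>z. m x y z)"
  shows "sweedler sU c (\<lambda>x y. sweedler sU x (\<lambda>u v. m u v y)) =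
         sweedler sU c (\<lambda>x y. sweedler sU y (\<lambda>u v. m x u v))"
proof -
  have vs [lin]: "vector_space sU"
    by (rule linear_vector_space(2)[OF assms(1)])
  let ?L = "tlift scale qscale sU (\<lambda>x t. tlift scale scale sU (m x) t)"
  have L: "Vector_Spaces.linear qscale sU ?L"
    by (rule linear_tlift[OF vs])
  have L_tpure: "?L (tpure scale qscale x t) = tlift scale scale sU (m x) t" for x t
    by (rule tlift_tpure) (intro bilinear_mapI lin assms)
  have m_tpure: "tlift scale scale sU (m x) (tpure scale scale u v) = m x u v" for x u v
    by (rule tlift_tpure) (intro bilinear_mapI assms)
  have "?L (tassoc scale scale scale (tmap scale scale qscale scale comult id (comult c))) =
        sweedler sU c (\<lambda>x y. sweedler sU x (\<lambda>u v. m u v y))"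
    by (simp add: tassoc_tmap[OF vector_space_axioms vector_space_axioms vector_space_axioms]
        linear_tlift_commute[OF L] L_tpure m_tpure)
  moreover have "?L (tmap scale scale scale qscale id comult (comult c)) =
        sweedler sU c (\<lambda>x y. sweedler sU y (\<lambda>u v. m x u v))"
    by (simp add: tmap_def linear_tlift_commute[OF L] L_tpure)
  ultimately show ?thesis
    by (simp add: coassoc)
qed

text \<open>
  Both sides are \<open>m c\<^sup>1 c\<^sup>2 c\<^sup>3 c\<^sup>4\<close>: on the left \<open>c\<^sup>1\<close> and \<open>c\<^sup>4\<close> are split off first, on the right \<open>c\<close>
  is halved twice.
\<close>

lemma sweedler_coassoc4:
  assumes m [lin]: "\<And>v q y. Vector_Spaces.linear scale sU (\<lambda>x. m x v q y)"
    "\<And>u q y. Vector_Spaces.linear scale sU (\<lambda>x. m u x q y)"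
    "\<And>u v y. Vector_Spaces.linear scale sU (\<lambda>x. m u v x y)"
    "\<And>u v q. Vector_Spaces.linear scale sU (\<lambda>x. m u v q x)"
  shows "sweedler sU c (\<lambda>x y. sweedler sU x (\<lambda>u v. sweedler sU v (\<lambda>p q. m u p q y))) =
         sweedler sU c (\<lambda>x y. sweedler sU x (\<lambda>u v. sweedler sU y (\<lambda>p q. m u v p q)))"
proof -
  have vs [lin]: "vector_space sU"
    by (rule linear_vector_space(2)[OF m(1)])
  have "sweedler sU x (\<lambda>u v. sweedler sU v (\<lambda>p q. m u p q y)) =
        sweedler sU x (\<lambda>u v. sweedler sU u (\<lambda>p q. m p q v y))" for x y
    by (rule sweedler_coassoc[symmetric]) (intro lin)+
  then have "sweedler sU c (\<lambda>x y. sweedler sU x (\<lambda>u v. sweedler sU v (\<lambda>p q. m u p q y))) =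
      sweedler sU c (\<lambda>x y. sweedler sU x (\<lambda>u v. sweedler sU u (\<lambda>p q. m p q v y)))"
    by simp
  also have "\<dots> = sweedler sU c (\<lambda>x y. sweedler sU y (\<lambda>v w. sweedler sU x (\<lambda>p q. m p q v w)))"
    by (rule sweedler_coassoc) (intro lin)+
  also have "\<dots> = sweedler sU c (\<lambda>x y. sweedler sU x (\<lambda>u v. sweedler sU y (\<lambda>p q. m u v p q)))"
    by (subst tlift_swap[OF vs]) (rule refl)
  finally show ?thesis .
qed

lemma sweedler_counit_left:
  assumes "Vector_Spaces.linear scale sU m"
  shows "sweedler sU c (\<lambda>x y. sU (counit x) (m y)) = m c"
  using linear_tlift_commute[OF assms, of scale scale "\<lambda>x y. scale (counit x) y" "comult c"]
  by (simp add: counit_left linear_scale[OF assms])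

lemma sweedler_counit_right:
  assumes "Vector_Spaces.linear scale sU m"
  shows "sweedler sU c (\<lambda>x y. sU (counit y) (m x)) = m c"
  using linear_tlift_commute[OF assms, of scale scale "\<lambda>x y. scale (counit y) x" "comult c"]
  by (simp add: counit_right linear_scale[OF assms])

end


context hopf_algebra
begin

lemma linear_mult_left [lin]:
  "Vector_Spaces.linear s scale p \<Longrightarrow> Vector_Spaces.linear s scale (\<lambda>x. p x * h)"
  by (simp add: Vector_Spaces.linear_iff distrib_right scale_mult_left)

lemma linear_mult_right [lin]:
  "Vector_Spaces.linear s scale p \<Longrightarrow> Vector_Spaces.linear s scale (\<lambda>x. h * p x)"
  by (simp add: Vector_Spaces.linear_iff distrib_left scale_mult_right)

lemma linear_antipode [lin]:
  "Vector_Spaces.linear s scale p \<Longrightarrow> Vector_Spaces.linear s scale (\<lambda>x. antipode (p x))"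
  by (rule linear_comp[OF antipode_linear])

end

section \<open>Module coalgebras\<close>

locale module_coalgebra =
  H: hopf_algebra sH \<Delta>H \<epsilon>H S + C: coalgebra sC \<Delta>C \<epsilon>C
  for sH :: "'k::field \<Rightarrow> 'h::ring_1 \<Rightarrow> 'h"
    and \<Delta>H :: "'h \<Rightarrow> ('k, 'h, 'h) tensor" and \<epsilon>H :: "'h \<Rightarrow> 'k" and S :: "'h \<Rightarrow> 'h"
    and sC :: "'k \<Rightarrow> 'c::ab_group_add \<Rightarrow> 'c"
    and \<Delta>C :: "'c \<Rightarrow> ('k, 'c, 'c) tensor" and \<epsilon>C :: "'c \<Rightarrow> 'k" +
  fixes act :: "'c \<Rightarrow> 'h \<Rightarrow> 'c"
  assumes act_bilinear: "bilinear_map sC sH sC act"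
    and act_one: "act c 1 = c"
    and act_act: "act (act c g) h = act c (g * h)"
    and comult_act: "\<Delta>C (act c h) =
        tlift sC sC qscale (\<lambda>c1 c2.
          tlift sH sH qscale (\<lambda>h1 h2. tpure sC sC (act c1 h1) (act c2 h2)) (\<Delta>H h)) (\<Delta>C c)"
    and counit_act: "\<epsilon>C (act c h) = \<epsilon>C c * \<epsilon>H h"
begin

lemma linear_act_left [lin]:
  "Vector_Spaces.linear s sC p \<Longrightarrow> Vector_Spaces.linear s sC (\<lambda>x. act (p x) h)"
  by (rule linear_bilinear_left[OF act_bilinear])

lemma linear_act_right [lin]:
  "Vector_Spaces.linear s sH p \<Longrightarrow> Vector_Spaces.linear s sC (\<lambda>x. act c (p x))"
  by (rule linear_bilinear_right[OF act_bilinear])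

lemma sweedler_act:
  assumes "\<And>y. Vector_Spaces.linear sC sU (\<lambda>x. m x y)" "\<And>x. Vector_Spaces.linear sC sU (\<lambda>y. m x y)"
  shows "C.sweedler sU (act c h) m =
         C.sweedler sU c (\<lambda>x y. H.sweedler sU h (\<lambda>a b. m (act x a) (act y b)))"
proof -
  have vs: "vector_space sU"
    by (rule linear_vector_space(2)[OF assms(1)])
  have "tlift sC sC sU m (tpure sC sC x y) = m x y" for x y
    by (rule tlift_tpure) (intro bilinear_mapI assms)
  then show ?thesis
    by (simp add: comult_act linear_tlift_commute[OF linear_tlift[OF vs]])
qed

text \<open>
  These maps are the linear maps on \<open>D = C / I\<close>, pulled back to \<open>C\<close>: they are the linear maps that
  vanish on the generators of \<open>I\<close>.
\<close>

definition invariant :: "('k \<Rightarrow> 'u::ab_group_add \<Rightarrow> 'u) \<Rightarrow> ('c \<Rightarrow> 'u) \<Rightarrow> bool" where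
  "invariant sU F \<longleftrightarrow> Vector_Spaces.linear sC sU F \<and> (\<forall>c h. F (act c h) = sU (\<epsilon>H h) (F c))"

abbreviation coinvariants :: "'c set" where
  "coinvariants \<equiv> coinv_D \<epsilon>H sC \<Delta>C act"

lemma subspace_coideal: "module.subspace sC (coideal_I \<epsilon>H sC act)"
  unfolding coideal_I_def by (rule C.subspace_span)

lemma proj_D_eq_iff: "proj_D \<epsilon>H sC act x = proj_D \<epsilon>H sC act y \<longleftrightarrow> x - y \<in> coideal_I \<epsilon>H sC act"
  unfolding proj_D_def by (rule qproj_eq_iff[OF C.vector_space_axioms subspace_coideal])

lemma linear_proj_D: "Vector_Spaces.linear sC qscale (proj_D \<epsilon>H sC act)"
  unfolding proj_D_def by (rule linear_qproj[OF C.vector_space_axioms])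

lemma invariant_eq_0_on_coideal:
  assumes "invariant (*) \<psi>" "x \<in> coideal_I \<epsilon>H sC act"
  shows "\<psi> x = 0"
proof -
  interpret k: vector_space "(*) :: 'k \<Rightarrow> 'k \<Rightarrow> 'k" by (rule vector_space_field)
  interpret p: vector_space_pair sC "(*) :: 'k \<Rightarrow> 'k \<Rightarrow> 'k" ..
  have lin: "Vector_Spaces.linear sC (*) \<psi>" and inv: "\<And>c h. \<psi> (act c h) = \<epsilon>H h * \<psi> c"
    using assms(1) by (auto simp: invariant_def)
  show ?thesis
    using assms(2) unfolding coideal_I_def
    by (rule p.linear_eq_0_on_span[OF lin, rotated])
       (auto simp: linear_diff[OF lin] linear_scale[OF lin] inv)
qed

text \<open>
  The functionals \<open>\<phi> \<circ> \<pi>\<close> for \<open>\<phi>\<close> in \<open>D\<^sup>*\<close> are the invariant ones, so \<open>D\<close> can be avoided from here on.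
\<close>

lemma coinvariants_iff:
  "c \<in> coinvariants \<longleftrightarrow>
     (\<forall>\<psi>. invariant (*) \<psi> \<longrightarrow>
        C.sweedler sC c (\<lambda>x y. sC (\<psi> y) x) = C.sweedler sC c (\<lambda>x y. sC (\<psi> x) y))"
  (is "_ \<longleftrightarrow> (\<forall>\<psi>. _ \<longrightarrow> ?E \<psi>)")
proof
  let ?\<pi> = "proj_D \<epsilon>H sC act" and ?r = "qrep sC (coideal_I \<epsilon>H sC act)"
  assume c: "c \<in> coinvariants"
  show "\<forall>\<psi>. invariant (*) \<psi> \<longrightarrow> ?E \<psi>"
  proof (intro allI impI)
    fix \<psi> assume \<psi>: "invariant (*) \<psi>"
    then have lin: "Vector_Spaces.linear sC (*) \<psi>"
      by (simp add: invariant_def)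
    have "Vector_Spaces.linear qscale (*) (\<lambda>d. \<psi> (?r d))"
      by (rule linear_comp[OF lin qrep(1)[OF C.vector_space_axioms]])
    then have "(\<lambda>d. \<psi> (?r d)) \<in> dual_on qscale (range ?\<pi>)"
      by (simp add: dual_on_def Vector_Spaces.linear_iff)
    moreover have "\<psi> (?r (?\<pi> x)) = \<psi> x" for x
    proof -
      have "?\<pi> (?r (?\<pi> x)) = ?\<pi> x"
        unfolding proj_D_def by (rule qrep(2)[OF C.vector_space_axioms])
      then have "\<psi> (?r (?\<pi> x) - x) = 0"
        by (intro invariant_eq_0_on_coideal[OF \<psi>]) (simp add: proj_D_eq_iff)
      then show ?thesis
        by (simp add: linear_diff[OF lin])
    qed
    ultimately show "?E \<psi>"
      using c by (auto simp: coinv_D_def Let_def dest!: bspec)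
  qed
next
  let ?\<pi> = "proj_D \<epsilon>H sC act"
  assume E: "\<forall>\<psi>. invariant (*) \<psi> \<longrightarrow> ?E \<psi>"
  have "invariant (*) (\<lambda>x. \<phi> (?\<pi> x))" if \<phi>: "\<phi> \<in> dual_on qscale (range ?\<pi>)" for \<phi>
  proof -
    have "?\<pi> (act x h) = qscale (\<epsilon>H h) (?\<pi> x)" for x h
    proof -
      have "act x h - sC (\<epsilon>H h) x \<in> coideal_I \<epsilon>H sC act"
        unfolding coideal_I_def by (rule C.span_base) blast
      then show ?thesis
        by (simp add: proj_D_eq_iff[symmetric] linear_scale[OF linear_proj_D])
    qed
    then show ?thesis
      using \<phi> linear_proj_D vector_space_field
      by (auto simp: invariant_def dual_on_def Vector_Spaces.linear_iff)
  qed
  then show "c \<in> coinvariants"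
    using E by (auto simp: coinv_D_def Let_def)
qed

text \<open>
  The definition of \<open>C\<^sup>D\<close> concerns functionals on \<open>D\<close>.  By testing with functionals on \<open>U\<close> it extends
  to all linear maps on \<open>D\<close>, that is, \<open>c\<^sup>1 \<otimes> F(c\<^sup>2) = c\<^sup>2 \<otimes> F(c\<^sup>1)\<close>.
\<close>

lemma coinvariant_swap:
  assumes "c \<in> coinvariants" "invariant sU F" "bilinear_map sC sU sW m"
  shows "C.sweedler sW c (\<lambda>x y. m x (F y)) = C.sweedler sW c (\<lambda>x y. m y (F x))"
proof (rule tlift_eq_by_functionals[OF assms(3)])
  fix \<beta> assume \<beta>: "Vector_Spaces.linear sU (*) \<beta>"
  have "invariant (*) (\<lambda>x. \<beta> (F x))"
    using assms(2) linear_comp[OF \<beta>] by (auto simp: invariant_def linear_scale[OF \<beta>])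
  then show "C.sweedler sC c (\<lambda>x y. sC (\<beta> (F y)) x) = C.sweedler sC c (\<lambda>x y. sC (\<beta> (F x)) y)"
    using assms(1) by (auto simp: coinvariants_iff)
qed

lemma subspace_coinvariants: "module.subspace sC coinvariants"
proof (rule C.subspaceI)
  have lin: "Vector_Spaces.linear sC sC (\<lambda>c. C.sweedler sC c (\<lambda>x y. sC (\<psi> y) x) -
      C.sweedler sC c (\<lambda>x y. sC (\<psi> x) y))" for \<psi>
    by (intro linear_minus lin)
  have iff: "c \<in> coinvariants \<longleftrightarrow> (\<forall>\<psi>. invariant (*) \<psi> \<longrightarrow> C.sweedler sC c (\<lambda>x y. sC (\<psi> y) x) -
      C.sweedler sC c (\<lambda>x y. sC (\<psi> x) y) = 0)" for c
    by (simp add: coinvariants_iff)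
  show "0 \<in> coinvariants"
    unfolding iff using linear_diff[OF lin, of _ 0 0] by simp
  show "x + y \<in> coinvariants" if "x \<in> coinvariants" "y \<in> coinvariants" for x y
    using that unfolding iff using lin by (simp add: Vector_Spaces.linear_iff)
  show "sC a x \<in> coinvariants" if "x \<in> coinvariants" for a x
    using that unfolding iff using lin by (simp add: Vector_Spaces.linear_iff)
qed

lemma act_coinvariants:
  assumes "c \<in> coinvariants"
  shows "act c h \<in> coinvariants"
  unfolding coinvariants_iff
proof (intro allI impI)
  fix \<psi> assume inv: "invariant (*) \<psi>"
  then have \<psi> [lin]: "\<And>s p. Vector_Spaces.linear s sC p \<Longrightarrow> Vector_Spaces.linear s (*) (\<lambda>x. \<psi> (p x))"
    and \<psi>_act: "\<And>x a. \<psi> (act x a) = \<epsilon>H a * \<psi> x"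
    using linear_comp[of sC "(*)" \<psi>] by (auto simp: invariant_def)
  have L: "H.sweedler sC h (\<lambda>a b. sC (\<psi> (act y b)) (act x a)) = sC (\<psi> y) (act x h)" for x y
  proof -
    have "H.sweedler sC h (\<lambda>a b. sC (\<psi> (act y b)) (act x a)) = 
        H.sweedler sC h (\<lambda>a b. sC (\<epsilon>H b) (sC (\<psi> y) (act x a)))"
      by (simp add: \<psi>_act)
    also have "\<dots> = sC (\<psi> y) (act x h)"
      by (rule H.sweedler_counit_right) (intro lin)
    finally show ?thesis .
  qed
  have R: "H.sweedler sC h (\<lambda>a b. sC (\<psi> (act x a)) (act y b)) = sC (\<psi> x) (act y h)" for x y
  proof -
    have "H.sweedler sC h (\<lambda>a b. sC (\<psi> (act x a)) (act y b)) = 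
        H.sweedler sC h (\<lambda>a b. sC (\<epsilon>H a) (sC (\<psi> x) (act y b)))"
      by (simp add: \<psi>_act)
    also have "\<dots> = sC (\<psi> x) (act y h)"
      by (rule H.sweedler_counit_left) (intro lin)
    finally show ?thesis .
  qed
  have "C.sweedler sC (act c h) (\<lambda>x y. sC (\<psi> y) x) = C.sweedler sC c (\<lambda>x y. sC (\<psi> y) (act x h))"
    by (subst sweedler_act) (intro lin | simp add: L)+
  also have "\<dots> = C.sweedler sC c (\<lambda>x y. sC (\<psi> x) (act y h))"
    by (rule coinvariant_swap[OF assms inv, of sC "\<lambda>x a. sC a (act x h)"]) (intro bilinear_mapI lin)
  also have "\<dots> = C.sweedler sC (act c h) (\<lambda>x y. sC (\<psi> x) y)"
    by (subst sweedler_act) (intro lin | simp add: R)+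
  finally show "C.sweedler sC (act c h) (\<lambda>x y. sC (\<psi> y) x) = C.sweedler sC (act c h) (\<lambda>x y. sC (\<psi> x) y)" .
qed

end


section \<open>Cleft coextensions\<close>

locale cleft_module_coalgebra = module_coalgebra sH \<Delta>H \<epsilon>H S sC \<Delta>C \<epsilon>C act
  for sH :: "'k::field \<Rightarrow> 'h::ring_1 \<Rightarrow> 'h"
    and \<Delta>H :: "'h \<Rightarrow> ('k, 'h, 'h) tensor" and \<epsilon>H :: "'h \<Rightarrow> 'k" and S :: "'h \<Rightarrow> 'h"
    and sC :: "'k \<Rightarrow> 'c::ab_group_add \<Rightarrow> 'c"
    and \<Delta>C :: "'c \<Rightarrow> ('k, 'c, 'c) tensor" and \<epsilon>C :: "'c \<Rightarrow> 'k"
    and act :: "'c \<Rightarrow> 'h \<Rightarrow> 'c" +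
  fixes f g :: "'c \<Rightarrow> 'h"
  assumes cointegral: "total_cointegral sH \<epsilon>H sC \<epsilon>C act f"
    and inverse: "is_convolution_inverse sH sC \<Delta>C \<epsilon>C f g"
begin

lemma linear_f [lin]: "Vector_Spaces.linear s sC p \<Longrightarrow> Vector_Spaces.linear s sH (\<lambda>x. f (p x))"
  by (rule linear_comp[of sC]) (use cointegral in \<open>auto simp: total_cointegral_def\<close>)

lemma linear_g [lin]: "Vector_Spaces.linear s sC p \<Longrightarrow> Vector_Spaces.linear s sH (\<lambda>x. g (p x))"
  by (rule linear_comp[of sC]) (use inverse in \<open>auto simp: is_convolution_inverse_def\<close>)

lemma f_act: "f (act c h) = f c * h"
  and counit_f: "\<epsilon>H (f c) = \<epsilon>C c"
  using cointegral by (auto simp: total_cointegral_def)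

lemma f_conv_g: "C.sweedler sH c (\<lambda>x y. f x * g y) = sH (\<epsilon>C c) 1"
  and g_conv_f: "C.sweedler sH c (\<lambda>x y. g x * f y) = sH (\<epsilon>C c) 1"
  using inverse by (auto simp: is_convolution_inverse_def)

lemma mult_tlift: "a * tlift sV sW sH m t = tlift sV sW sH (\<lambda>v w. a * m v w) t"
  by (rule linear_tlift_commute) (intro lin)

lemma tlift_mult: "tlift sV sW sH m t * a = tlift sV sW sH (\<lambda>v w. m v w * a) t"
  by (rule linear_tlift_commute[where F = "\<lambda>z. z * a"]) (intro lin)

lemma act_tlift: "act c (tlift sV sW sH m t) = tlift sV sW sC (\<lambda>v w. act c (m v w)) t"
  by (rule linear_tlift_commute) (intro lin)

lemma tlift_act: "act (tlift sV sW sC m t) h = tlift sV sW sC (\<lambda>v w. act (m v w) h) t"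
  by (rule linear_tlift_commute[where F = "\<lambda>z. act z h"]) (intro lin)

lemma scale_tlift: "sC a (tlift sV sW sC m t) = tlift sV sW sC (\<lambda>v w. sC a (m v w)) t"
  by (rule linear_tlift_commute) (intro lin)

lemma act_scale_one: "act c (sH a 1) = sC a c"
  using linear_scale[OF linear_act_right[OF linear_ident[OF H.vector_space_axioms]]] act_one by simp

text \<open>
  The maps \<open>N \<mapsto> f(c\<^sup>1) N(c\<^sup>2)\<close> and \<open>N \<mapsto> h\<^sup>1 N(h\<^sup>2)\<close> of convolution by \<open>f\<close> and by the identity of \<open>H\<close>
  have as left inverses the convolutions by \<open>g\<close> and by \<open>S\<close>.
\<close>

lemma g_f_cancel:
  assumes "Vector_Spaces.linear sC sH N"
  shows "C.sweedler sH c (\<lambda>x y. g x * C.sweedler sH y (\<lambda>p q. f p * N q)) = N c"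
proof -
  note [lin] = linear_comp[OF assms]
  have "C.sweedler sH c (\<lambda>x y. g x * C.sweedler sH y (\<lambda>p q. f p * N q)) =
        C.sweedler sH c (\<lambda>x y. C.sweedler sH y (\<lambda>p q. g x * f p * N q))"
    by (simp add: mult_tlift mult.assoc)
  also have "\<dots> = C.sweedler sH c (\<lambda>x y. C.sweedler sH x (\<lambda>p q. g p * f q * N y))"
    by (rule C.sweedler_coassoc[symmetric]) (intro lin)+
  also have "\<dots> = C.sweedler sH c (\<lambda>x y. sH (\<epsilon>C x) (N y))"
    by (simp add: tlift_mult[symmetric] g_conv_f H.scale_mult_left)
  also have "\<dots> = N c"
    by (rule C.sweedler_counit_left) (intro lin)
  finally show ?thesis .
qed

lemma antipode_cancel:
  assumes "Vector_Spaces.linear sH sH N"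
  shows "H.sweedler sH h (\<lambda>x y. S x * H.sweedler sH y (\<lambda>p q. p * N q)) = N h"
proof -
  note [lin] = linear_comp[OF assms]
  have "H.sweedler sH h (\<lambda>x y. S x * H.sweedler sH y (\<lambda>p q. p * N q)) =
        H.sweedler sH h (\<lambda>x y. H.sweedler sH y (\<lambda>p q. S x * p * N q))"
    by (simp add: mult_tlift mult.assoc)
  also have "\<dots> = H.sweedler sH h (\<lambda>x y. H.sweedler sH x (\<lambda>p q. S p * q * N y))"
    by (rule H.sweedler_coassoc[symmetric]) (intro lin)+
  also have "\<dots> = H.sweedler sH h (\<lambda>x y. sH (\<epsilon>H x) (N y))"
    by (simp add: tlift_mult[symmetric] H.antipode_left H.scale_mult_left)
  also have "\<dots> = N h"
    by (rule H.sweedler_counit_left) (intro lin)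
  finally show ?thesis .
qed

text \<open>
  Both \<open>g(c h)\<close> and \<open>S(h) g(c)\<close> are convolution inverse to \<open>f(c h) = f(c) h\<close> on \<open>C \<otimes> H\<close>.  The left
  factor \<open>f(c\<^sup>1) h\<^sup>1\<close> is cancelled in two stages: \<open>f(c\<^sup>1) h\<^sup>1 g(c\<^sup>2 h\<^sup>2) = \<epsilon>(c) \<epsilon>(h)\<close> gives
  \<open>h\<^sup>1 g(c h\<^sup>2) = \<epsilon>(h) g(c)\<close> by convolution with \<open>g\<close>, and then convolution with \<open>S\<close> isolates \<open>g(c h)\<close>.
\<close>

lemma g_act: "g (act c h) = S h * g c"
proof -
  define W where "W h c = H.sweedler sH h (\<lambda>r s. r * g (act c s))" for h c
  have W_lin [lin]: "Vector_Spaces.linear s sC p \<Longrightarrow> Vector_Spaces.linear s sH (\<lambda>x. W h (p x))" for s p h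
    unfolding W_def by (intro lin)
  have fW: "C.sweedler sH c (\<lambda>p q. f p * W h q) = sH (\<epsilon>C c * \<epsilon>H h) 1" for c h
  proof -
    have "C.sweedler sH (act c h) (\<lambda>x y. f x * g y) =
        C.sweedler sH c (\<lambda>p q. H.sweedler sH h (\<lambda>r s. f (act p r) * g (act q s)))"
      by (rule sweedler_act) (intro lin)+
    then show ?thesis
      by (simp add: f_conv_g counit_act W_def mult_tlift f_act mult.assoc)
  qed
  have W: "W h c = sH (\<epsilon>H h) (g c)" for h c
  proof -
    have "W h c = C.sweedler sH c (\<lambda>x y. g x * C.sweedler sH y (\<lambda>p q. f p * W h q))"
      by (rule g_f_cancel[symmetric]) (intro lin)
    also have "\<dots> = C.sweedler sH c (\<lambda>x y. sH (\<epsilon>C y) (sH (\<epsilon>H h) (g x)))"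
      by (simp add: fW H.scale_mult_right)
    also have "\<dots> = sH (\<epsilon>H h) (g c)"
      by (rule C.sweedler_counit_right) (intro lin)
    finally show ?thesis .
  qed
  have "g (act c h) = H.sweedler sH h (\<lambda>x y. S x * H.sweedler sH y (\<lambda>p q. p * g (act c q)))"
    by (rule antipode_cancel[symmetric]) (intro lin)
  also have "\<dots> = H.sweedler sH h (\<lambda>x y. sH (\<epsilon>H y) (S x * g c))"
    using W by (simp add: W_def H.scale_mult_right)
  also have "\<dots> = S h * g c"
    by (rule H.sweedler_counit_right) (intro lin)
  finally show ?thesis .
qed

lemma counit_g: "\<epsilon>H (g c) = \<epsilon>C c"
proof -
  have "\<epsilon>H (g c) = C.sweedler (*) c (\<lambda>x y. \<epsilon>C x * \<epsilon>H (g y))"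
    by (rule C.sweedler_counit_left[symmetric]) (intro lin)
  also have "\<dots> = \<epsilon>H (C.sweedler sH c (\<lambda>x y. f x * g y))"
    by (simp add: linear_tlift_commute[OF H.counit_linear] H.counit_mult counit_f)
  also have "\<dots> = \<epsilon>C c"
    by (simp add: f_conv_g linear_scale[OF H.counit_linear] H.counit_one)
  finally show ?thesis .
qed

text \<open>
  Being \<open>H\<close>-invariant, this map factors as \<open>C \<rightarrow> D \<rightarrow> C\<close>; the second map is the section of \<open>\<pi>\<close> that
  trivializes the cleft coextension, \<open>C \<cong> D \<otimes> H\<close>.
\<close>

definition cleft_section :: "'c \<Rightarrow> 'c" where
  "cleft_section c = C.sweedler sC c (\<lambda>x y. act x (g y))"

lemma linear_cleft_section [lin]:
  "Vector_Spaces.linear s sC p \<Longrightarrow> Vector_Spaces.linear s sC (\<lambda>x. cleft_section (p x))"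
  unfolding cleft_section_def by (intro lin)

lemma invariant_cleft_section: "invariant sC cleft_section"
proof -
  have "cleft_section (act c h) = sC (\<epsilon>H h) (cleft_section c)" for c h
  proof -
    have "cleft_section (act c h) = C.sweedler sC c (\<lambda>x y. H.sweedler sC h (\<lambda>a b. act (act x a) (g (act y b))))"
      unfolding cleft_section_def by (rule sweedler_act) (intro lin)+
    also have "\<dots> = C.sweedler sC c (\<lambda>x y. act x (H.sweedler sH h (\<lambda>a b. a * S b) * g y))"
      by (simp add: act_act g_act act_tlift tlift_mult mult.assoc)
    also have "\<dots> = C.sweedler sC c (\<lambda>x y. sC (\<epsilon>H h) (act x (g y)))"
      using linear_scale[OF linear_act_right[OF linear_ident[OF H.vector_space_axioms]]]
      by (simp add: H.antipode_right H.scale_mult_left)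
    also have "\<dots> = sC (\<epsilon>H h) (cleft_section c)"
      unfolding cleft_section_def by (rule linear_tlift_commute[symmetric]) (intro lin)
    finally show ?thesis .
  qed
  moreover have "Vector_Spaces.linear sC sC cleft_section"
    using linear_cleft_section[OF linear_ident[OF C.vector_space_axioms]] .
  ultimately show ?thesis
    by (simp add: invariant_def)
qed

text \<open>
  With \<open>r\<close> the cleft section, the trivialization \<open>c \<mapsto> \<pi>(c\<^sup>1) \<otimes> f(c\<^sup>2)\<close> is inverted by
  \<open>\<pi>(c) \<otimes> h \<mapsto> r(c) h\<close>.
\<close>

lemma cleft_section_act_f: "C.sweedler sC c (\<lambda>x y. act (cleft_section x) (f y)) = c"
proof -
  have "C.sweedler sC c (\<lambda>x y. act (cleft_section x) (f y)) =
        C.sweedler sC c (\<lambda>x y. C.sweedler sC x (\<lambda>p q. act p (g q * f y)))"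
    by (simp add: cleft_section_def tlift_act act_act)
  also have "\<dots> = C.sweedler sC c (\<lambda>x y. C.sweedler sC y (\<lambda>p q. act x (g p * f q)))"
    by (rule C.sweedler_coassoc) (intro lin)+
  also have "\<dots> = C.sweedler sC c (\<lambda>x y. sC (\<epsilon>C y) x)"
    by (simp add: act_tlift[symmetric] g_conv_f act_scale_one)
  also have "\<dots> = c"
    by (rule C.counit_right)
  finally show ?thesis .
qed

abbreviation coaction :: "'c \<Rightarrow> ('k, 'h, 'c) tensor" where
  "coaction \<equiv> cleft_coaction sH sC \<Delta>C f g"

lemma coaction_eq:
  "coaction c = C.sweedler qscale c (\<lambda>x y. C.sweedler qscale x (\<lambda>u v. tpure sH sC (g y * f u) v))"
  unfolding cleft_coaction_def comult2_def by (rule tlift3_tmap) (intro lin)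

lemma tlift_coaction:
  assumes "bilinear_map sH sC sU m"
  shows "tlift sH sC sU m (coaction c) =
    C.sweedler sU c (\<lambda>x y. C.sweedler sU x (\<lambda>u v. m (g y * f u) v))"
proof -
  have "vector_space sU"
    using assms by (auto simp: bilinear_map_def Vector_Spaces.linear_iff)
  then show ?thesis
    by (simp add: coaction_eq linear_tlift_commute[OF linear_tlift] tlift_tpure[OF assms])
qed

lemma linear_coaction [lin]:
  "Vector_Spaces.linear s sC p \<Longrightarrow> Vector_Spaces.linear s qscale (\<lambda>x. coaction (p x))"
  unfolding coaction_eq by (intro lin)

text \<open>
  The canonical map sends \<open>m \<otimes> a\<close>, for \<open>a \<otimes> m = g(c\<^sup>3) f(c\<^sup>1) \<otimes> c\<^sup>2\<close>, to \<open>c\<^sup>2 \<otimes> c\<^sup>3 g(c\<^sup>4) f(c\<^sup>1)\<close>.  With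
  \<open>r\<close> the cleft section this is \<open>c\<^sup>2 \<otimes> r(c\<^sup>3) f(c\<^sup>1)\<close>.  As \<open>r\<close> is invariant and \<open>c\<close> is in \<open>C\<^sup>D\<close>, the
  legs may be rotated to \<open>c\<^sup>3 \<otimes> r(c\<^sup>1) f(c\<^sup>2)\<close>, where \<open>r\<close> and \<open>f\<close> recombine to \<open>c\<^sup>2 \<otimes> c\<^sup>1\<close>.
\<close>

lemma coaction_can:
  assumes c: "c \<in> coinvariants" and m: "bilinear_map sC sC sU m"
  shows "tlift sH sC sU (\<lambda>a x. C.sweedler sU x (\<lambda>p q. m p (act q a))) (coaction c) =
         C.sweedler sU c (\<lambda>x y. m y x)"
proof -
  note [lin] = linear_bilinear_left[OF m] linear_bilinear_right[OF m] bilinear_vector_space[OF m]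
  have "tlift sH sC sU (\<lambda>a x. C.sweedler sU x (\<lambda>p q. m p (act q a))) (coaction c) =
      C.sweedler sU c (\<lambda>x y. C.sweedler sU x (\<lambda>u v. C.sweedler sU v (\<lambda>p q. m p (act q (g y * f u)))))"
    by (rule tlift_coaction) (intro bilinear_mapI lin)
  also have "\<dots> = C.sweedler sU c (\<lambda>x y. C.sweedler sU x (\<lambda>u v. C.sweedler sU y (\<lambda>p q. m v (act p (g q * f u)))))"
    by (rule C.sweedler_coassoc4) (intro lin)+
  also have "\<dots> = C.sweedler sU c (\<lambda>x y. C.sweedler sU x (\<lambda>u v. m v (act (cleft_section y) (f u))))"
    by (simp add: cleft_section_def tlift_act act_act linear_tlift_commute[OF linear_bilinear_right[OF m linear_ident[OF C.vector_space_axioms]]])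
  also have "\<dots> = C.sweedler sU c (\<lambda>x y. C.sweedler sU y (\<lambda>u v. m v (act (cleft_section x) (f u))))"
    by (rule coinvariant_swap[OF c invariant_cleft_section]) (intro bilinear_mapI lin)
  also have "\<dots> = C.sweedler sU c (\<lambda>x y. C.sweedler sU x (\<lambda>u v. m y (act (cleft_section u) (f v))))"
    by (rule C.sweedler_coassoc[symmetric]) (intro lin)+
  also have "\<dots> = C.sweedler sU c (\<lambda>x y. m y x)"
    by (simp add: cleft_section_act_f linear_tlift_commute[OF linear_bilinear_right[OF m linear_ident[OF C.vector_space_axioms]], symmetric])
  finally show ?thesis .
qed

text \<open>
  \<open>u \<otimes> v \<mapsto> u\<^sup>1 \<otimes> g(u\<^sup>2) f(v)\<close> is left inverse to the canonical map \<open>x \<otimes> a \<mapsto> x\<^sup>1 \<otimes> x\<^sup>2 a\<close>.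
\<close>

lemma can_inverse:
  assumes n: "bilinear_map sC sH sU n"
  shows "C.sweedler sU x (\<lambda>z y. C.sweedler sU z (\<lambda>p q. n p (g q * f (act y a)))) = n x a"
proof -
  note [lin] = linear_bilinear_left[OF n] linear_bilinear_right[OF n] bilinear_vector_space[OF n]
  have n_tlift: "n p (tlift sC sC sH k t) = tlift sC sC sU (\<lambda>v w. n p (k v w)) t" for p k t
    by (rule linear_tlift_commute) (intro lin)
  have n_scale: "n p (sH r h) = sU r (n p h)" for p r h
    by (rule linear_scale[where F = "n p"]) (intro lin)
  have "C.sweedler sU x (\<lambda>z y. C.sweedler sU z (\<lambda>p q. n p (g q * f (act y a)))) =
      C.sweedler sU x (\<lambda>p t. C.sweedler sU t (\<lambda>q y. n p (g q * f y * a)))"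
    by (subst C.sweedler_coassoc) (intro lin | simp add: f_act mult.assoc)+
  also have "\<dots> = C.sweedler sU x (\<lambda>p t. sU (\<epsilon>C t) (n p a))"
    by (simp add: n_tlift[symmetric] tlift_mult[symmetric] g_conv_f H.scale_mult_left n_scale)
  also have "\<dots> = n x a"
    by (rule C.sweedler_counit_right) (intro lin)
  finally show ?thesis .
qed

text \<open>
  It has to be shown that \<open>\<beta>(a) \<psi>(m\<^sup>2) m\<^sup>1 = \<beta>(a) \<psi>(m\<^sup>1) m\<^sup>2\<close> for \<open>\<beta>\<close> in \<open>H\<^sup>*\<close> and \<open>\<psi>\<close> in \<open>D\<^sup>*\<close>.  The left
  side is a bilinear function \<open>M\<close> of \<open>m\<^sup>1 \<otimes> m\<^sup>2 a\<close>, hence equals \<open>M(c\<^sup>2, c\<^sup>1)\<close>, and this is the right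
  side written out with \<open>a = g(c\<^sup>4) f(c\<^sup>1)\<close>, \<open>m\<^sup>1 = c\<^sup>2\<close> and \<open>m\<^sup>2 = c\<^sup>3\<close>.
\<close>

lemma coaction_coinvariants:
  assumes c: "c \<in> coinvariants"
  shows "coaction c \<in> tensor_space sH sC UNIV coinvariants"
proof (rule tensor_space_by_functionals)
  show "coaction c \<in> tensor_space sH sC UNIV UNIV"
  proof -
    interpret q: vector_space "qscale :: 'k \<Rightarrow> ('k, 'h \<times> 'c \<Rightarrow>\<^sub>0 'k) quot \<Rightarrow> _"
      by (rule vector_space_qscale)
    show ?thesis
      unfolding coaction_eq tlift_def free_lift_def case_prod_beta tensor_space_def
      by (intro q.span_sum q.span_scale q.span_base) blast
  qed
  fix \<beta> assume \<beta>: "Vector_Spaces.linear sH (*) \<beta>"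
  note [lin] = linear_comp[OF \<beta>]
  show "tlift sH sC sC (\<lambda>v w. sC (\<beta> v) w) (coaction c) \<in> coinvariants"
    unfolding coinvariants_iff
  proof (intro allI impI)
    fix \<psi> assume inv: "invariant (*) \<psi>"
    then have \<psi>: "Vector_Spaces.linear sC (*) \<psi>" and \<psi>_act: "\<And>x a. \<psi> (act x a) = \<epsilon>H a * \<psi> x"
      by (auto simp: invariant_def)
    note [lin] = linear_comp[OF \<psi>]
    have push: "C.sweedler sC (tlift sH sC sC (\<lambda>v w. sC (\<beta> v) w) (coaction c)) k =
        tlift sH sC sC (\<lambda>a x. sC (\<beta> a) (C.sweedler sC x k)) (coaction c)" for k
    proof -
      have k: "Vector_Spaces.linear sC sC (\<lambda>c. C.sweedler sC c k)"
        by (intro lin)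
      show ?thesis
        by (simp add: linear_tlift_commute[OF k] linear_scale[OF k])
    qed
    \<comment> \<open>The first leg of \<open>w\<close> goes into the inverse of the canonical map, the second into \<open>\<psi>\<close>; the
      latter does not see the action of \<open>a\<close> on \<open>w\<close>.\<close>
    define M where "M z w = C.sweedler sC w (\<lambda>r s. C.sweedler sC z (\<lambda>p q.
      sC (\<beta> (g q * f r)) (sC (\<psi> s) p)))" for z w
    have M: "bilinear_map sC sC sC M"
      unfolding M_def by (intro bilinear_mapI lin)
    have expand: "sC (\<beta> a) (C.sweedler sC x (\<lambda>x y. sC (\<psi> y) x)) =
        C.sweedler sC x (\<lambda>z y. M z (act y a))" for a x
    proof -
      have "M z (act y a) = C.sweedler sC y (\<lambda>r s. C.sweedler sC z (\<lambda>p q.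
          sC (\<beta> (g q * f (act r a))) (sC (\<psi> s) p)))" for z y
      proof -
        have "M z (act y a) = C.sweedler sC y (\<lambda>r s. H.sweedler sC a (\<lambda>a1 a2.
            C.sweedler sC z (\<lambda>p q. sC (\<beta> (g q * f (act r a1))) (sC (\<psi> (act s a2)) p))))"
          unfolding M_def by (rule sweedler_act) (intro lin)+
        also have "\<dots> = C.sweedler sC y (\<lambda>r s. H.sweedler sC a (\<lambda>a1 a2.
            sC (\<epsilon>H a2) (C.sweedler sC z (\<lambda>p q. sC (\<beta> (g q * f (act r a1))) (sC (\<psi> s) p)))))"
          by (simp add: scale_tlift \<psi>_act mult_ac)
        also have "\<dots> = C.sweedler sC y (\<lambda>r s. C.sweedler sC z (\<lambda>p q.
            sC (\<beta> (g q * f (act r a))) (sC (\<psi> s) p)))"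
          by (subst H.sweedler_counit_right) (intro lin | rule refl)+
        finally show ?thesis .
      qed
      then have "C.sweedler sC x (\<lambda>z y. M z (act y a)) =
          C.sweedler sC x (\<lambda>z y. C.sweedler sC y (\<lambda>r s. C.sweedler sC z (\<lambda>p q.
            sC (\<beta> (g q * f (act r a))) (sC (\<psi> s) p))))"
        by simp
      also have "\<dots> = C.sweedler sC x (\<lambda>y s. C.sweedler sC y (\<lambda>z r. C.sweedler sC z (\<lambda>p q.
            sC (\<beta> (g q * f (act r a))) (sC (\<psi> s) p))))"
        by (rule C.sweedler_coassoc[symmetric]) (intro lin)+
      also have "\<dots> = C.sweedler sC x (\<lambda>y s. sC (\<beta> a) (sC (\<psi> s) y))"
        by (subst can_inverse[where n = "\<lambda>p b. sC (\<beta> b) (sC (\<psi> _) p)"])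
          (intro bilinear_mapI lin | rule refl)+
      also have "\<dots> = sC (\<beta> a) (C.sweedler sC x (\<lambda>x y. sC (\<psi> y) x))"
        by (rule scale_tlift[symmetric])
      finally show ?thesis ..
    qed
    have "C.sweedler sC (tlift sH sC sC (\<lambda>v w. sC (\<beta> v) w) (coaction c)) (\<lambda>x y. sC (\<psi> y) x) =
        C.sweedler sC c (\<lambda>x y. M y x)"
      unfolding push expand by (rule coaction_can[OF c M])
    also have "\<dots> = C.sweedler sC c (\<lambda>x y. C.sweedler sC x (\<lambda>u v. C.sweedler sC v (\<lambda>p q.
        sC (\<beta> (g y * f u)) (sC (\<psi> p) q))))"
      unfolding M_def by (rule C.sweedler_coassoc4[symmetric]) (intro lin)+
    also have "\<dots> = tlift sH sC sC (\<lambda>a x. sC (\<beta> a) (C.sweedler sC x (\<lambda>x y. sC (\<psi> x) y))) (coaction c)"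
      unfolding scale_tlift by (rule tlift_coaction[symmetric]) (intro bilinear_mapI lin)
    also have "\<dots> = C.sweedler sC (tlift sH sC sC (\<lambda>v w. sC (\<beta> v) w) (coaction c)) (\<lambda>x y. sC (\<psi> x) y)"
      by (rule push[symmetric])
    finally show "C.sweedler sC (tlift sH sC sC (\<lambda>v w. sC (\<beta> v) w) (coaction c)) (\<lambda>x y. sC (\<psi> y) x) =
        C.sweedler sC (tlift sH sC sC (\<lambda>v w. sC (\<beta> v) w) (coaction c)) (\<lambda>x y. sC (\<psi> x) y)" .
  qed
qed (intro lin)+

text \<open>
  Let \<open>b \<otimes> x\<close> be the coaction of \<open>m\<close>.  The map \<open>a \<otimes> b \<otimes> x \<mapsto> x\<^sup>1 \<otimes> x\<^sup>2 a \<otimes> x\<^sup>3 b\<close> has a left inverse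
  \<open>Q\<close>, so it is enough to compare the images of \<open>a\<^sup>1 \<otimes> a\<^sup>2 \<otimes> m\<close> and \<open>a \<otimes> b \<otimes> x\<close>.  The first is
  \<open>m\<^sup>1 \<otimes> (m\<^sup>2 a)\<^sup>1 \<otimes> (m\<^sup>2 a)\<^sup>2 = c\<^sup>3 \<otimes> c\<^sup>1 \<otimes> c\<^sup>2\<close>.  For the second, \<open>x\<^sup>1 \<otimes> x\<^sup>2 b = m\<^sup>2 \<otimes> m\<^sup>1\<close>, because \<open>m\<close>
  may be taken in \<open>C\<^sup>D\<close>, whence \<open>x\<^sup>1 \<otimes> x\<^sup>2 a \<otimes> x\<^sup>3 b = m\<^sup>2 \<otimes> m\<^sup>3 a \<otimes> m\<^sup>1 = c\<^sup>3 \<otimes> c\<^sup>1 \<otimes> c\<^sup>2\<close>.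
\<close>

lemma coaction_coassoc:
  assumes c: "c \<in> coinvariants"
  shows "tassoc sH sH sC (tmap sH sC qscale sC \<Delta>H id (coaction c)) =
         tmap sH sC sH qscale id coaction (coaction c)"
proof -
  let ?T = "\<lambda>a b x. tpure sH qscale a (tpure sH sC b x)"
  \<comment> \<open>On \<open>u \<otimes> v \<otimes> w = x\<^sup>1 \<otimes> x\<^sup>2 a \<otimes> x\<^sup>3 b\<close> the last leg of \<open>u\<close> is adjacent to \<open>v\<close>, so it has to be the one
    that cancels against \<open>v\<close>; this leaves \<open>x\<^sup>1 \<otimes> x\<^sup>2 b\<close>.\<close>
  define Q where "Q u v w = C.sweedler qscale u (\<lambda>z y. C.sweedler qscale z (\<lambda>x q.
      ?T (g y * f v) (g q * f w) x))" for u v w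
  have Q [lin]:
    "Vector_Spaces.linear s sC p \<Longrightarrow> Vector_Spaces.linear s qscale (\<lambda>x. Q (p x) v w)"
    "Vector_Spaces.linear s sC p \<Longrightarrow> Vector_Spaces.linear s qscale (\<lambda>x. Q u (p x) w)"
    "Vector_Spaces.linear s sC p \<Longrightarrow> Vector_Spaces.linear s qscale (\<lambda>x. Q u v (p x))"
    for s p u v w
    unfolding Q_def by (intro lin; assumption)+
  have T_Q: "?T a b x = C.sweedler qscale x (\<lambda>z w. C.sweedler qscale z (\<lambda>u v. Q u (act v a) (act w b)))"
    for a b x
  proof -
    have "C.sweedler qscale z (\<lambda>u v. Q u (act v a) (act w b)) =
        C.sweedler qscale z (\<lambda>x q. ?T a (g q * f (act w b)) x)" for z w
      unfolding Q_def
      by (rule can_inverse[where n = "\<lambda>p \<alpha>. C.sweedler qscale p (\<lambda>x q. ?T \<alpha> (g q * f (act w b)) x)"])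
        (intro bilinear_mapI lin)
    then have "C.sweedler qscale x (\<lambda>z w. C.sweedler qscale z (\<lambda>u v. Q u (act v a) (act w b))) =
        C.sweedler qscale x (\<lambda>z w. C.sweedler qscale z (\<lambda>x q. ?T a (g q * f (act w b)) x))"
      by simp
    also have "\<dots> = ?T a b x"
      by (rule can_inverse[where n = "\<lambda>x \<beta>. ?T a \<beta> x"]) (intro bilinear_mapI lin)
    finally show ?thesis ..
  qed

  define N where "N z y = C.sweedler qscale y (\<lambda>v w. Q z v w)" for z y
  have N: "bilinear_map sC sC qscale N"
    unfolding N_def by (intro bilinear_mapI lin)
  \<comment> \<open>The coproduct of \<open>a\<close> is absorbed by that of \<open>x\<^sup>2 a\<close>.\<close>
  have left: "H.sweedler qscale a (\<lambda>b b'. ?T b b' x) = C.sweedler qscale x (\<lambda>z y. N z (act y a))" for a x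
  proof -
    have "H.sweedler qscale a (\<lambda>b b'. ?T b b' x) = H.sweedler qscale a (\<lambda>b b'.
        C.sweedler qscale x (\<lambda>z y. C.sweedler qscale y (\<lambda>v w. Q z (act v b) (act w b'))))"
      unfolding T_Q by (subst C.sweedler_coassoc) (intro lin | rule refl)+
    also have "\<dots> = C.sweedler qscale x (\<lambda>z y. C.sweedler qscale y (\<lambda>v w.
        H.sweedler qscale a (\<lambda>b b'. Q z (act v b) (act w b'))))"
      by (simp only: tlift_swap[OF vector_space_quot, where sV = sH and sX = sC])
    also have "\<dots> = C.sweedler qscale x (\<lambda>z y. N z (act y a))"
      unfolding N_def by (subst sweedler_act) (intro lin | rule refl)+
    finally show ?thesis .
  qed
  have "tassoc sH sH sC (tmap sH sC qscale sC \<Delta>H id (coaction c)) =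
      tlift sH sC qscale (\<lambda>a x. H.sweedler qscale a (\<lambda>b b'. ?T b b' x)) (coaction c)"
    by (rule tassoc_tmap) (intro lin)+
  also have "\<dots> = C.sweedler qscale c (\<lambda>x y. N y x)"
    unfolding left by (rule coaction_can[OF c N])
  also have "\<dots> = C.sweedler qscale c (\<lambda>x y. C.sweedler qscale y (\<lambda>w u. Q u x w))"
    unfolding N_def by (rule C.sweedler_coassoc) (intro lin)+
  also have "\<dots> = tlift sH sC qscale (\<lambda>a n. C.sweedler qscale n (\<lambda>z v.
      C.sweedler qscale z (\<lambda>x u. Q u (act v a) x))) (coaction c)"
    by (rule coaction_can[OF c, symmetric]) (intro bilinear_mapI lin)
  also have "\<dots> = tlift sH sC qscale (\<lambda>a n. tpure sH qscale a (coaction n)) (coaction c)"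
  proof (rule tensor_space_eqI[OF coaction_coinvariants[OF c]])
    fix a n assume n: "n \<in> coinvariants"
    have "tpure sH qscale a (coaction n) = tlift sH sC qscale (\<lambda>b x. ?T a b x) (coaction n)"
    proof -
      have a: "Vector_Spaces.linear qscale qscale (tpure sH qscale a)"
        by (intro lin)
      have "tlift sH sC qscale (tpure sH sC) (coaction n) = coaction n"
        by (rule tlift_tpure_id[OF _ _ coaction_coinvariants[OF n]]) (intro lin)+
      then show ?thesis
        using linear_tlift_commute[OF a, of sH sC "tpure sH sC" "coaction n"] by simp
    qed
    also have "\<dots> = C.sweedler qscale n (\<lambda>x y. C.sweedler qscale y (\<lambda>u v. Q u (act v a) x))"
      unfolding T_Q by (rule coaction_can[OF n]) (intro bilinear_mapI lin)
    also have "\<dots> = C.sweedler qscale n (\<lambda>z v. C.sweedler qscale z (\<lambda>x u. Q u (act v a) x))"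
      by (rule C.sweedler_coassoc[symmetric]) (intro lin)+
    finally show "C.sweedler qscale n (\<lambda>z v. C.sweedler qscale z (\<lambda>x u. Q u (act v a) x)) =
        tpure sH qscale a (coaction n)" ..
  qed (intro bilinear_mapI lin)+
  also have "\<dots> = tmap sH sC sH qscale id coaction (coaction c)"
    by (simp add: tmap_def)
  finally show ?thesis .
qed

lemma coaction_act:
  "coaction (act c h) =
     tlift3 sH sH sH qscale (\<lambda>h1 h2 h3.
       tlift sH sC qscale (\<lambda>x y. tpure sH sC (S h3 * x * h1) (act y h2)) (coaction c))
     (comult2 sH \<Delta>H h)"
proof -
  have "coaction (act c h) = C.sweedler qscale c (\<lambda>x y. H.sweedler qscale h (\<lambda>a b.
      C.sweedler qscale (act x a) (\<lambda>u v. tpure sH sC (g (act y b) * f u) v)))"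
    unfolding coaction_eq by (rule sweedler_act) (intro lin)+
  also have "\<dots> = C.sweedler qscale c (\<lambda>x y. H.sweedler qscale h (\<lambda>a b.
      C.sweedler qscale x (\<lambda>u v. H.sweedler qscale a (\<lambda>r s.
        tpure sH sC (S b * (g y * f u) * r) (act v s)))))"
    by (subst sweedler_act) (intro lin | simp add: g_act f_act mult.assoc)+
  also have "\<dots> = H.sweedler qscale h (\<lambda>a b. H.sweedler qscale a (\<lambda>r s.
      C.sweedler qscale c (\<lambda>x y. C.sweedler qscale x (\<lambda>u v.
        tpure sH sC (S b * (g y * f u) * r) (act v s)))))"
    by (simp only: tlift_swap[OF vector_space_quot, where sV = sC and sX = sH])
  also have "\<dots> = H.sweedler qscale h (\<lambda>a b. H.sweedler qscale a (\<lambda>r s.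
      tlift sH sC qscale (\<lambda>x y. tpure sH sC (S b * x * r) (act y s)) (coaction c)))"
    by (subst tlift_coaction) (intro bilinear_mapI lin | simp)+
  also have "\<dots> = tlift3 sH sH sH qscale (\<lambda>h1 h2 h3.
       tlift sH sC qscale (\<lambda>x y. tpure sH sC (S h3 * x * h1) (act y h2)) (coaction c))
     (comult2 sH \<Delta>H h)"
    unfolding comult2_def by (rule tlift3_tmap[symmetric]) (intro lin)
  finally show ?thesis .
qed

text \<open>Stability is \<open>\<epsilon>(m\<^sup>1) m\<^sup>2 a = \<epsilon>(c\<^sup>2) c\<^sup>1\<close>.\<close>

lemma coaction_stable:
  assumes "c \<in> coinvariants"
  shows "tlift sH sC sC (\<lambda>a x. act x a) (coaction c) = c"
proof -
  have "C.sweedler sC x (\<lambda>p q. sC (\<epsilon>C p) (act q a)) = act x a" for x a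
    by (rule C.sweedler_counit_left) (intro lin)
  then have "tlift sH sC sC (\<lambda>a x. act x a) (coaction c) = C.sweedler sC c (\<lambda>x y. sC (\<epsilon>C y) x)"
    using coaction_can[OF assms, of sC "\<lambda>u v. sC (\<epsilon>C u) v"] by (simp add: bilinear_mapI lin)
  then show ?thesis
    by (simp add: C.counit_right)
qed

lemma coaction_counit: "tlift sH sC sC (\<lambda>h v. sC (\<epsilon>H h) v) (coaction c) = c"
proof -
  have "tlift sH sC sC (\<lambda>h v. sC (\<epsilon>H h) v) (coaction c) =
      C.sweedler sC c (\<lambda>x y. C.sweedler sC x (\<lambda>u v. sC (\<epsilon>H (g y * f u)) v))"
    by (rule tlift_coaction) (intro bilinear_mapI lin)
  also have "\<dots> = C.sweedler sC c (\<lambda>x y. sC (\<epsilon>C y) (C.sweedler sC x (\<lambda>u v. sC (\<epsilon>C u) v)))"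
  proof -
    have "sC (\<epsilon>C y) (C.sweedler sC x (\<lambda>u v. sC (\<epsilon>C u) v)) =
        C.sweedler sC x (\<lambda>u v. sC (\<epsilon>C y) (sC (\<epsilon>C u) v))" for x y
      by (rule linear_tlift_commute) (intro lin)
    then show ?thesis
      by (simp add: H.counit_mult counit_f counit_g)
  qed
  also have "\<dots> = c"
    by (simp add: C.counit_left C.counit_right)
  finally show ?thesis .
qed

theorem coinvariants_stable_anti_yetter_drinfeld:
  "anti_yetter_drinfeld sH \<Delta>H \<epsilon>H S sC coinvariants act coaction \<and>
   stable_on sH sC coinvariants act coaction"
proof -
  have "right_module_on sH sC coinvariants act"
    unfolding right_module_on_def
    using subspace_coinvariants act_bilinear act_coinvariants act_one act_act by blast
  moreover have "left_comodule_on sH \<Delta>H \<epsilon>H sC coinvariants coaction"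
    unfolding left_comodule_on_def
    using subspace_coinvariants linear_coaction[OF linear_ident[OF C.vector_space_axioms]]
      coaction_coinvariants coaction_coassoc coaction_counit by blast
  ultimately show ?thesis
    using coaction_act coaction_stable by (auto simp: anti_yetter_drinfeld_def stable_on_def)
qed

end

theorem proposition3p28:
  fixes sH :: "'k::field \<Rightarrow> 'h::ring_1 \<Rightarrow> 'h"
    and \<Delta>H :: "'h \<Rightarrow> ('k, 'h, 'h) tensor" and \<epsilon>H :: "'h \<Rightarrow> 'k" and S :: "'h \<Rightarrow> 'h"
    and sC :: "'k \<Rightarrow> 'c::ab_group_add \<Rightarrow> 'c"
    and \<Delta>C :: "'c \<Rightarrow> ('k, 'c, 'c) tensor" and \<epsilon>C :: "'c \<Rightarrow> 'k"
    and act :: "'c \<Rightarrow> 'h \<Rightarrow> 'c"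
    and f finv :: "'c \<Rightarrow> 'h"
  assumes "hopf_algebra sH \<Delta>H \<epsilon>H S" and "bij S"
    and "hopf_galois_coextension sH \<Delta>H \<epsilon>H sC \<Delta>C \<epsilon>C act"
    and "total_cointegral sH \<epsilon>H sC \<epsilon>C act f"
    and "is_convolution_inverse sH sC \<Delta>C \<epsilon>C f finv"
  shows "anti_yetter_drinfeld sH \<Delta>H \<epsilon>H S sC (coinv_D \<epsilon>H sC \<Delta>C act) act
           (cleft_coaction sH sC \<Delta>C f finv) \<and>
         stable_on sH sC (coinv_D \<epsilon>H sC \<Delta>C act) act (cleft_coaction sH sC \<Delta>C f finv)"
proof -
  have C: "right_module_coalgebra sH \<Delta>H \<epsilon>H sC \<Delta>C \<epsilon>C act"
    using assms(3) by (simp add: hopf_galois_coextension_def)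
  interpret H: hopf_algebra sH \<Delta>H \<epsilon>H S by fact
  interpret C: coalgebra sC \<Delta>C \<epsilon>C
    using C by (simp add: right_module_coalgebra_def)
  interpret cleft_module_coalgebra sH \<Delta>H \<epsilon>H S sC \<Delta>C \<epsilon>C act f finv
    using C assms(4,5) by unfold_locales (auto simp: right_module_coalgebra_def)
  show ?thesis
    by (rule coinvariants_stable_anti_yetter_drinfeld)
qed

end
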